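(* Let $n\ge2$ and let $t=(t_{i,j})_{1\le i<j\le n}$ be independent variables. Consider the factorization, over the field of rational functions in the $t_{i,j}$, $$X^{(n)}(-t)\,\bar w_0^{(n)}=Y\cdot T\cdot X^{(n)}(p),$$ with $Y$ lower triangular unipotent, $T$ diagonal, and $p=(p_{i,j})_{1\le i<j\le n}$ rational functions of $t$. With $\hat j=n+1-j$: a) for all $1\le i<j\le n$, $$p_{i,j}=\frac{1}{t_{i,i+\hat j}}\cdot\frac{t_{i-1,i+\hat j-1}}{t_{i-1,i+\hat j}}\cdot\frac{t_{i-2,i+\hat j-1}}{t_{i-2,i+\hat j}}\cdots\frac{t_{1,i+\hat j-1}}{t_{1,i+\hat j}}\,;$$ b) $T=\sum_{i=1}^nT_ie_{i,i}$ with $$T_i=\frac{t_{i,n}t_{i,n-1}\cdots t_{i,i+1}}{t_{1,i}t_{2,i}\cdots t_{i-1,i}}$$ (empty products equal $1$); c) the map $t\mapsto p$ preserves the measure: $\prod_{i<j}\frac{dt_{i,j}}{t_{i,j}}=\prod_{i<j}\frac{dp_{i,j}}{p_{i,j}}$ (as measures on the positive orthant).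
   Context: $e_{a,b}$ are the $n\times n$ matrix units, $\mathrm{Id}$ the identity matrix. For variables $t=(t_{i,j})_{1\le i<j\le n}$, $$X^{(n)}(t)=R_{n-1}R_{n-2}\cdots R_1,\qquad R_i=(\mathrm{Id}+t_{i,n}e_{i,i+1})(\mathrm{Id}+t_{i,n-1}e_{i+1,i+2})\cdots(\mathrm{Id}+t_{i,i+1}e_{n-1,n}),$$ so that $t_{i,j}$ multiplies $e_{n-j+i,\,n-j+i+1}$. $X^{(n)}(-t)$ is obtained by replacing every $t_{i,j}$ by $-t_{i,j}$, and $\bar w_0^{(n)}=\sum_{k=1}^n(-1)^{k-1}e_{k,n+1-k}$. The map $X^{(n)}(t)\mapsto X^{(n)}(p)$ is called the Berenstein–Zelevinsky (BZ) transform and $T$ the (Cartan) twist. *)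

theory Defs
  imports
    "HOL-Analysis.Analysis"
    "HOL-Library.Poly_Mapping"
    "HOL-Library.Nat_Bijection"
    "HOL-Computational_Algebra.Fraction_Field"
    "Jordan_Normal_Form.Matrix"
begin

text \<open>
  Matrix units are numbered by rows and columns 1 to n, whereas entries of the type
  \<^typ>\<open>'a mat\<close> are addressed from 0. Families such as t and p are functions
  nat => nat => 'a of which only the values at (i, j) with 1 <= i < j <= n matter.
\<close>

definition idx :: "nat \<Rightarrow> (nat \<times> nat) set" where
  "idx n = {(i, j). 1 \<le> i \<and> i < j \<and> j \<le> n}"


subsection \<open>The matrices\<close>

definition munit :: "nat \<Rightarrow> nat \<Rightarrow> nat \<Rightarrow> 'a::zero_neq_one mat" where
  "munit n a b = mat n n (\<lambda>(r, c). if r + 1 = a \<and> c + 1 = b then 1 else 0)"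

definition mat_sum :: "nat \<Rightarrow> ('b \<Rightarrow> 'a::comm_monoid_add mat) \<Rightarrow> 'b set \<Rightarrow> 'a mat" where
  "mat_sum n F S = mat n n (\<lambda>rc. \<Sum>k\<in>S. F k $$ rc)"

definition mat_prod_list :: "nat \<Rightarrow> 'a::semiring_1 mat list \<Rightarrow> 'a mat" where
  "mat_prod_list n As = foldr (*) As (1\<^sub>m n)"

text \<open>The factors of R i are listed for j = n, n - 1, ..., i + 1.\<close>

definition Rmat :: "nat \<Rightarrow> (nat \<Rightarrow> nat \<Rightarrow> 'a::comm_ring_1) \<Rightarrow> nat \<Rightarrow> 'a mat" where
  "Rmat n t i = mat_prod_list n
     (map (\<lambda>j. 1\<^sub>m n + t i j \<cdot>\<^sub>m munit n (n - j + i) (n - j + i + 1)) (rev [i + 1..<n + 1]))"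

definition Xmat :: "nat \<Rightarrow> (nat \<Rightarrow> nat \<Rightarrow> 'a::comm_ring_1) \<Rightarrow> 'a mat" where
  "Xmat n t = mat_prod_list n (map (Rmat n t) (rev [1..<n]))"

definition w0bar :: "nat \<Rightarrow> 'a::comm_ring_1 mat" where
  "w0bar n = mat_sum n (\<lambda>k. (- 1) ^ (k - 1) \<cdot>\<^sub>m munit n k (n + 1 - k)) {1..n}"

definition lower_unipotent :: "'a::zero_neq_one mat \<Rightarrow> bool" where
  "lower_unipotent Y \<longleftrightarrow>
     (\<forall>i<dim_row Y. Y $$ (i, i) = 1) \<and> (\<forall>i<dim_row Y. \<forall>j<dim_col Y. i < j \<longrightarrow> Y $$ (i, j) = 0)"

definition BZ_factorization ::
  "nat \<Rightarrow> (nat \<Rightarrow> nat \<Rightarrow> 'a::comm_ring_1) \<Rightarrow> 'a mat \<Rightarrow> 'a mat \<Rightarrow> (nat \<Rightarrow> nat \<Rightarrow> 'a) \<Rightarrow> bool" where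
  "BZ_factorization n t Y T p \<longleftrightarrow>
     Y \<in> carrier_mat n n \<and> lower_unipotent Y \<and>
     T \<in> carrier_mat n n \<and> diagonal_mat T \<and>
     Xmat n (\<lambda>i j. - t i j) * w0bar n = Y * T * Xmat n p"


subsection \<open>Rational functions in the independent variables\<close>

text \<open>
  A polynomial is a finitely supported map from exponent vectors to coefficients.
  The variable with index (i, j) is numbered by \<^const>\<open>prod_encode\<close>, since the
  integral domain instance for such polynomials needs linearly ordered variables.
\<close>

type_synonym mpol = "(nat \<Rightarrow>\<^sub>0 nat) \<Rightarrow>\<^sub>0 real"
type_synonym ratfun = "mpol fract"

definition tvar :: "nat \<Rightarrow> nat \<Rightarrow> ratfun" where
  "tvar i j = Fract (Poly_Mapping.single (Poly_Mapping.single (prod_encode (i, j)) 1) 1) 1"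

definition mpol_eval :: "(nat \<times> nat \<Rightarrow> real) \<Rightarrow> mpol \<Rightarrow> real" where
  "mpol_eval x q = (\<Sum>m\<in>Poly_Mapping.keys q. Poly_Mapping.lookup q m *
     (\<Prod>k\<in>Poly_Mapping.keys m. x (prod_decode k) ^ Poly_Mapping.lookup m k))"

text \<open>
  The rational function f is regular at x with value v if some representation of f as
  a fraction has nonzero denominator at x and value v there.
\<close>

definition ratfun_value :: "(nat \<times> nat \<Rightarrow> real) \<Rightarrow> ratfun \<Rightarrow> real \<Rightarrow> bool" where
  "ratfun_value x f v \<longleftrightarrow>
     (\<exists>a b. f = Fract a b \<and> mpol_eval x b \<noteq> 0 \<and> v = mpol_eval x a / mpol_eval x b)"

definition ratfun_regular :: "(nat \<times> nat \<Rightarrow> real) \<Rightarrow> ratfun \<Rightarrow> bool" where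
  "ratfun_regular x f \<longleftrightarrow> (\<exists>v. ratfun_value x f v)"

definition ratfun_eval :: "(nat \<times> nat \<Rightarrow> real) \<Rightarrow> ratfun \<Rightarrow> real" where
  "ratfun_eval x f = (THE v. ratfun_value x f v)"


subsection \<open>The measure on the positive orthant\<close>

definition pos_orthant :: "nat \<Rightarrow> (nat \<times> nat \<Rightarrow> real) set" where
  "pos_orthant n = (\<Pi>\<^sub>E ij\<in>idx n. {0<..})"

definition log_measure :: "nat \<Rightarrow> (nat \<times> nat \<Rightarrow> real) measure" where
  "log_measure n =
     density (restrict_space (\<Pi>\<^sub>M ij\<in>idx n. lborel) (pos_orthant n))
       (\<lambda>x. ennreal (\<Prod>ij\<in>idx n. 1 / x ij))"

definition real_map :: "nat \<Rightarrow> (nat \<Rightarrow> nat \<Rightarrow> ratfun) \<Rightarrow> (nat \<times> nat \<Rightarrow> real) \<Rightarrow> (nat \<times> nat \<Rightarrow> real)" where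
  "real_map n p x = (\<lambda>(i, j)\<in>idx n. ratfun_eval x (p i j))"

text \<open>
  The equality of the two product measures says that the map t |-> p is a change of
  coordinates on the positive orthant (everywhere defined, bijective, measurable) under
  which the measure with density 1 / prod t with respect to Lebesgue measure is invariant.
\<close>

definition preserves_log_measure :: "nat \<Rightarrow> (nat \<Rightarrow> nat \<Rightarrow> ratfun) \<Rightarrow> bool" where
  "preserves_log_measure n p \<longleftrightarrow>
     (\<forall>x\<in>pos_orthant n. \<forall>(i, j)\<in>idx n. ratfun_regular x (p i j)) \<and>
     bij_betw (real_map n p) (pos_orthant n) (pos_orthant n) \<and>
     real_map n p \<in> log_measure n \<rightarrow>\<^sub>M log_measure n \<and>
     distr (log_measure n) (log_measure n) (real_map n p) = log_measure n"

end

theory Submission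
  imports Defs
begin

text \<open>
  The factorization is obtained by peeling off one factor. Write \<open>X' = R\<^sub>n\<^sub>-\<^sub>1 \<cdots> R\<^sub>2\<close>,
  which is the matrix of size \<open>n - 1\<close> for the shifted parameters, bordered by a 1. Multiplying out,
  \<open>R\<^sub>1(-t) w\<^sub>0\<close> equals a block lower triangular matrix times \<open>R\<^sub>1(p)\<close>, whose lower right block is
  the \<open>w\<^sub>0\<close> of size \<open>n - 1\<close> times the diagonal matrix of the \<open>1 / t\<^sub>1\<^sub>,\<^sub>j\<close>. Moving this
  diagonal matrix through the remaining factors rescales their parameters, which
  accounts for the quotients \<open>t\<^sub>1\<^sub>,\<^sub>j\<^sub>-\<^sub>1 / t\<^sub>1\<^sub>,\<^sub>j\<close> in \<open>p\<close> and for the denominators of \<open>T\<close>.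
  Uniqueness is that of the LU decomposition together with the injectivity of \<open>X\<close> at
  nonvanishing parameters.

  For the measure, each coordinate of \<open>p\<close> is, up to a permutation of the indices, the inverse of a
  coordinate of \<open>t\<close> times a function of the rows above it, and \<open>dx / x\<close> is invariant
  under inversion and dilation.
\<close>

subsection \<open>Entries of the factors\<close>

lemma mult_entry:
  "A \<in> carrier_mat n m \<Longrightarrow> B \<in> carrier_mat m k \<Longrightarrow> i < n \<Longrightarrow> j < k
    \<Longrightarrow> (A * B) $$ (i, j) = (\<Sum>l<m. A $$ (i, l) * B $$ (l, j))"
  by (auto simp: scalar_prod_def atLeast0LessThan)

lemma munit_carrier [simp]: "munit n a b \<in> carrier_mat n n"
  by (simp add: munit_def)

lemma mat_prod_list_carrier:
  "(\<And>A. A \<in> set As \<Longrightarrow> A \<in> carrier_mat n n) \<Longrightarrow> mat_prod_list n As \<in> carrier_mat n n"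
  by (induction As) (auto simp: mat_prod_list_def intro!: mult_carrier_mat)

lemma mat_prod_list_snoc:
  "(\<And>A. A \<in> set As \<Longrightarrow> A \<in> carrier_mat n n) \<Longrightarrow> B \<in> carrier_mat n n
    \<Longrightarrow> mat_prod_list n (As @ [B]) = mat_prod_list n As * B"
proof (induction As)
  case (Cons A As)
  then have "mat_prod_list n As \<in> carrier_mat n n" "A \<in> carrier_mat n n"
    by (auto intro: mat_prod_list_carrier)
  with Cons show ?case
    by (simp add: mat_prod_list_def assoc_mult_mat[of _ n n _ n _ n])
qed (simp add: mat_prod_list_def)

text \<open>Multiplication by such a factor on the left is a row operation. The indices
  \<open>r\<close> and \<open>r'\<close> count from 1, whereas \<open>a\<close> and \<open>b\<close>
  count from 0.\<close>

lemma elementary_mult_entry: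
  fixes A :: "'a::comm_ring_1 mat"
  assumes A: "A \<in> carrier_mat n n" and "a < n" "b < n" "1 \<le> r'" "r' \<le> n"
  shows "((1\<^sub>m n + s \<cdot>\<^sub>m munit n r r') * A) $$ (a, b)
    = A $$ (a, b) + (if a + 1 = r then s * A $$ (r' - 1, b) else 0)"
proof -
  have "((1\<^sub>m n + s \<cdot>\<^sub>m munit n r r') * A) $$ (a, b)
      = (\<Sum>l<n. (1\<^sub>m n + s \<cdot>\<^sub>m munit n r r') $$ (a, l) * A $$ (l, b))"
    using assms by (intro mult_entry) auto
  also have "\<dots> = (\<Sum>l<n. (if a = l then A $$ (l, b) else 0)
      + (if r' - 1 = l then (if a + 1 = r then s * A $$ (l, b) else 0) else 0))"
    using assms by (intro sum.cong) (auto simp: munit_def algebra_simps)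
  also have "\<dots> = A $$ (a, b) + (if a + 1 = r then s * A $$ (r' - 1, b) else 0)"
    using assms less_le_trans[of "r' - 1" r' n] by (simp add: sum.distrib sum.delta')
  finally show ?thesis .
qed

text \<open>The parameter \<open>t i j\<close> sits at the superdiagonal position
  \<open>l = n - j + i\<close>, and these positions increase from left to right in the product.
  Getting from \<open>a\<close> to \<open>b\<close> therefore uses each position from
  \<open>a + 1\<close> to \<open>b\<close> exactly once. \<open>E k\<close> collects the factors
  with \<open>j <= k\<close>, which touch only rows from \<open>n - k + i\<close> on (counted from
  1); the induction puts the next factor on the left.\<close>

lemma Rmat_prefix_entry:
  fixes t :: "nat \<Rightarrow> nat \<Rightarrow> 'a::comm_ring_1"
  assumes "i \<le> k" "k \<le> n" "1 \<le> i"
  defines "E \<equiv> \<lambda>k. mat_prod_list n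
     (map (\<lambda>j. 1\<^sub>m n + t i j \<cdot>\<^sub>m munit n (n - j + i) (n - j + i + 1)) (rev [i + 1..<k + 1]))"
  shows "a < n \<Longrightarrow> b < n \<Longrightarrow> E k $$ (a, b) =
    (if a = b then 1 else if a < b \<and> n - k + i \<le> a + 1 then \<Prod>l=a+1..b. t i (n + i - l) else 0)"
  using assms(1,2)
proof (induction k arbitrary: a b rule: dec_induct)
  case base
  then show ?case using assms(3) by (auto simp: E_def mat_prod_list_def)
next
  case (step k)
  let ?r = "n - Suc k + i"
  have E: "E (Suc k) = (1\<^sub>m n + t i (Suc k) \<cdot>\<^sub>m munit n ?r (?r + 1)) * E k"
    using step.hyps by (simp add: E_def mat_prod_list_def)
  have "E k \<in> carrier_mat n n"
    unfolding E_def by (intro mat_prod_list_carrier) auto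
  then have eq: "E (Suc k) $$ (a, b)
      = E k $$ (a, b) + (if a + 1 = ?r then t i (Suc k) * E k $$ (?r, b) else 0)"
    unfolding E using step.prems step.hyps assms(3) by (subst elementary_mult_entry) auto
  show ?case
  proof (cases "a + 1 = ?r")
    case False
    then show ?thesis
      using eq step.IH[of a b] step.prems step.hyps by auto
  next
    case True
    have r: "?r < n" using step.prems step.hyps by simp
    \<comment> \<open>The position of the new factor carries precisely the new parameter.\<close>
    have i: "n + i - (a + 1) = Suc k" using True step.prems step.hyps by simp
    have "(\<Prod>l=a+1..b. t i (n + i - l)) = t i (Suc k) * (\<Prod>l=?r+1..b. t i (n + i - l))" if "a < b"
      using that i True by (simp add: prod.atLeast_Suc_atMost flip: True)
    then show ?thesis
      using eq True r step.IH[of a b] step.IH[of ?r b] step.prems step.hyps by auto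
  qed
qed

lemma Rmat_entry:
  fixes t :: "nat \<Rightarrow> nat \<Rightarrow> 'a::comm_ring_1"
  assumes "1 \<le> i" "i \<le> n" "a < n" "b < n"
  shows "Rmat n t i $$ (a, b) =
    (if a = b then 1 else if a < b \<and> i \<le> a + 1 then \<Prod>l=a+1..b. t i (n + i - l) else 0)"
  using Rmat_prefix_entry[of i n n a b t] assms by (simp add: Rmat_def)

lemma Rmat_carrier [simp]: "Rmat n t i \<in> carrier_mat n n"
  unfolding Rmat_def by (intro mat_prod_list_carrier) auto

lemma Xmat_carrier [simp]: "Xmat n t \<in> carrier_mat n n"
  unfolding Xmat_def by (intro mat_prod_list_carrier) auto

lemma w0bar_carrier [simp]: "w0bar n \<in> carrier_mat n n"
  by (simp add: w0bar_def mat_sum_def)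

lemma dim_XR [simp]:
  "dim_row (Rmat n t i) = n" "dim_col (Rmat n t i) = n"
  "dim_row (Xmat n t) = n" "dim_col (Xmat n t) = n"
  "dim_row (w0bar n) = n" "dim_col (w0bar n) = n"
  using Rmat_carrier Xmat_carrier w0bar_carrier by blast+

section \<open>Passage from size m to size m + 1 by bordering\<close>

definition shift :: "(nat \<Rightarrow> nat \<Rightarrow> 'a) \<Rightarrow> nat \<Rightarrow> nat \<Rightarrow> 'a" where
  "shift t i j = t (Suc i) (Suc j)"

definition block1 :: "'a::zero_neq_one mat \<Rightarrow> 'a mat" where
  "block1 A = four_block_mat (1\<^sub>m 1) (0\<^sub>m 1 (dim_col A)) (0\<^sub>m (dim_row A) 1) A"

lemma block1_carrier [simp]: "A \<in> carrier_mat m m \<Longrightarrow> block1 A \<in> carrier_mat (Suc m) (Suc m)"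
  unfolding block1_def using four_block_carrier_mat[of "1\<^sub>m 1" 1 1 A m m] by simp

lemma block1_one: "block1 (1\<^sub>m m :: 'a::zero_neq_one mat) = 1\<^sub>m (Suc m)"
  unfolding block1_def by (rule eq_matI) auto

lemma block1_mult:
  fixes A B :: "'a::comm_ring_1 mat"
  assumes "A \<in> carrier_mat m m" "B \<in> carrier_mat m m"
  shows "block1 (A * B) = block1 A * block1 B"
  using assms mult_four_block_mat[of "1\<^sub>m 1 :: 'a mat" 1 1 "0\<^sub>m 1 m" m "0\<^sub>m m 1" m A "1\<^sub>m 1" 1 "0\<^sub>m 1 m" m "0\<^sub>m m 1" B]
  by (auto simp: block1_def)

lemma mat_prod_list_block1:
  fixes As :: "'a::comm_ring_1 mat list"
  shows "(\<And>A. A \<in> set As \<Longrightarrow> A \<in> carrier_mat m m)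
    \<Longrightarrow> mat_prod_list (Suc m) (map block1 As) = block1 (mat_prod_list m As)"
proof (induction As)
  case (Cons A As)
  then have "mat_prod_list m As \<in> carrier_mat m m" "A \<in> carrier_mat m m"
    by (auto intro: mat_prod_list_carrier)
  with Cons show ?case
    by (simp add: mat_prod_list_def block1_mult[of _ m])
qed (simp add: mat_prod_list_def block1_one)

text \<open>Raising the size and both indices by one raises the position \<open>n - j + i\<close> by
  one, and all positions of this factor are at least \<open>Suc i\<close>, so the first row and
  column are untouched.\<close>

lemma Rmat_Suc:
  fixes t :: "nat \<Rightarrow> nat \<Rightarrow> 'a::comm_ring_1"
  assumes "1 \<le> i" "i \<le> m"
  shows "Rmat (Suc m) t (Suc i) = block1 (Rmat m (shift t) i)"
proof (rule eq_matI)
  fix a b assume "a < dim_row (block1 (Rmat m (shift t) i))" "b < dim_col (block1 (Rmat m (shift t) i))"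
  then have ab: "a < Suc m" "b < Suc m" by (auto simp: block1_def)
  have "(\<Prod>l=a+1..b. t (Suc i) (Suc m + Suc i - l)) = (\<Prod>l=a..b-1. t (Suc i) (Suc (m + i - l)))" if "a < b"
    by (rule prod.reindex_bij_witness[of _ Suc "\<lambda>l. l - 1"])
       (use that ab in \<open>auto simp: Suc_diff_le\<close>)
  then show "Rmat (Suc m) t (Suc i) $$ (a, b) = block1 (Rmat m (shift t) i) $$ (a, b)"
    using ab assms by (auto simp: block1_def Rmat_entry shift_def)
qed (auto simp: block1_def)

lemma Rmat_self_eq_one: "Rmat m t m = (1\<^sub>m m :: 'a::comm_ring_1 mat)"
  by (simp add: Rmat_def mat_prod_list_def)

text \<open>The factor of index 1 is the last one, and all factors before it are bordered. This
  recursion carries the inductions on the size; for \<open>m = 0\<close> the factor on the right is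
  an empty product.\<close>

lemma Xmat_Suc:
  fixes t :: "nat \<Rightarrow> nat \<Rightarrow> 'a::comm_ring_1"
  shows "Xmat (Suc m) t = block1 (Xmat m (shift t)) * Rmat (Suc m) t 1"
proof (cases m)
  case 0
  have "Rmat 1 t 1 = 1\<^sub>m 1"
    by (rule Rmat_self_eq_one)
  with 0 show ?thesis by (simp add: Xmat_def mat_prod_list_def block1_one)
next
  case (Suc k)
  have "[1..<Suc m] = 1 # map Suc [1..<m]"
    using Suc by (simp add: map_Suc_upt upt_conv_Cons del: upt_Suc)
  then have "rev [1..<Suc m] = map Suc (rev [1..<m]) @ [1]"
    by (simp add: rev_map)
  then have "Xmat (Suc m) t
      = mat_prod_list (Suc m) (map (Rmat (Suc m) t) (map Suc (rev [1..<m]))) * Rmat (Suc m) t 1"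
    unfolding Xmat_def by (simp only: map_append list.map) (rule mat_prod_list_snoc; auto)
  also have "map (Rmat (Suc m) t) (map Suc (rev [1..<m])) = map block1 (map (Rmat m (shift t)) (rev [1..<m]))"
    by (auto simp: Rmat_Suc)
  also have "mat_prod_list (Suc m) \<dots> = block1 (Xmat m (shift t))"
    unfolding Xmat_def by (rule mat_prod_list_block1) auto
  finally show ?thesis .
qed

lemma w0bar_entry:
  assumes "a < n" "b < n"
  shows "w0bar n $$ (a, b) = (if a + b + 1 = n then (- 1) ^ a else 0)"
proof -
  have "w0bar n $$ (a, b) = (\<Sum>k=1..n. ((- 1) ^ (k - 1) \<cdot>\<^sub>m munit n k (n + 1 - k)) $$ (a, b))"
    using assms by (simp add: w0bar_def mat_sum_def)
  also have "\<dots> = (\<Sum>k=1..n. if k = Suc a then if a + b + 1 = n then (- 1) ^ a else 0 else (0::'a))"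
    using assms by (intro sum.cong) (auto simp: munit_def)
  finally show ?thesis using assms by simp
qed

section \<open>Diagonal matrices and the rescaling of parameters\<close>

definition diagm :: "nat \<Rightarrow> (nat \<Rightarrow> 'a::zero) \<Rightarrow> 'a mat" where
  "diagm n d = mat n n (\<lambda>(a, b). if a = b then d a else 0)"

lemma diagm_carrier [simp]: "diagm n d \<in> carrier_mat n n"
  by (simp add: diagm_def)

lemma dim_diagm [simp]: "dim_row (diagm n d) = n" "dim_col (diagm n d) = n"
  by (simp_all add: diagm_def)

lemma mult_diagm_entry:
  fixes A :: "'a::comm_ring_1 mat"
  assumes "A \<in> carrier_mat n n" "a < n" "b < n"
  shows "(A * diagm n d) $$ (a, b) = A $$ (a, b) * d b"
    and "(diagm n d * A) $$ (a, b) = d a * A $$ (a, b)"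
proof -
  have "(A * diagm n d) $$ (a, b) = (\<Sum>l<n. A $$ (a, l) * diagm n d $$ (l, b))"
    using assms by (intro mult_entry) auto
  also have "\<dots> = (\<Sum>l<n. if l = b then A $$ (a, l) * d l else 0)"
    using assms by (intro sum.cong) (auto simp: diagm_def)
  finally show "(A * diagm n d) $$ (a, b) = A $$ (a, b) * d b"
    using assms by simp
  have "(diagm n d * A) $$ (a, b) = (\<Sum>l<n. diagm n d $$ (a, l) * A $$ (l, b))"
    using assms by (intro mult_entry) auto
  also have "\<dots> = (\<Sum>l<n. if l = a then d l * A $$ (l, b) else 0)"
    using assms by (intro sum.cong) (auto simp: diagm_def)
  finally show "(diagm n d * A) $$ (a, b) = d a * A $$ (a, b)"
    using assms by simp
qed

lemma mat_prod_list_intertwine: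
  fixes G :: "'a::comm_ring_1 mat"
  assumes "G \<in> carrier_mat n n"
    "\<And>i. i \<in> set js \<Longrightarrow> F i \<in> carrier_mat n n"
    "\<And>i. i \<in> set js \<Longrightarrow> H i \<in> carrier_mat n n"
    "\<And>i. i \<in> set js \<Longrightarrow> F i * G = G * H i"
  shows "mat_prod_list n (map F js) * G = G * mat_prod_list n (map H js)"
  using assms
proof (induction js)
  case Nil
  then show ?case by (simp add: mat_prod_list_def)
next
  case (Cons j js)
  let ?F = "mat_prod_list n (map F js)" and ?H = "mat_prod_list n (map H js)"
  have c: "?F \<in> carrier_mat n n" "?H \<in> carrier_mat n n"
      "F j \<in> carrier_mat n n" "H j \<in> carrier_mat n n" "G \<in> carrier_mat n n"
    using Cons.prems by (auto intro!: mat_prod_list_carrier)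
  have "F j * ?F * G = F j * (?F * G)"
    using c by (simp add: assoc_mult_mat[of _ n n _ n _ n])
  also have "\<dots> = F j * (G * ?H)"
    using Cons by simp
  also have "\<dots> = F j * G * ?H"
    using c by (simp add: assoc_mult_mat[of _ n n _ n _ n])
  also have "\<dots> = G * H j * ?H"
    using Cons.prems by simp
  also have "\<dots> = G * (H j * ?H)"
    using c by (simp add: assoc_mult_mat[of _ n n _ n _ n])
  finally show ?case by (simp add: mat_prod_list_def)
qed

text \<open>An entry (a, b) of a factor is a product over consecutive superdiagonal positions. The
  condition at position \<open>l\<close> trades \<open>d l\<close> for \<open>d (l - 1)\<close>, so
  over the whole product \<open>d b\<close> becomes \<open>d a\<close>.\<close>

lemma Xmat_scale:
  fixes p q :: "nat \<Rightarrow> nat \<Rightarrow> 'a::comm_ring_1"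
  assumes pq: "\<And>i l. 1 \<le> i \<Longrightarrow> i \<le> l \<Longrightarrow> l < n \<Longrightarrow> p i (n + i - l) * d l = d (l - 1) * q i (n + i - l)"
  shows "Xmat n p * diagm n d = diagm n d * Xmat n q"
  unfolding Xmat_def
proof (rule mat_prod_list_intertwine)
  fix i assume "i \<in> set (rev [1..<n])"
  then have i: "1 \<le> i" "i \<le> n" by auto
  show "Rmat n p i * diagm n d = diagm n d * Rmat n q i"
  proof (rule eq_matI)
    fix a b assume "a < dim_row (diagm n d * Rmat n q i)" "b < dim_col (diagm n d * Rmat n q i)"
    then have ab: "a < n" "b < n" by auto
    have "(\<Prod>l=a+1..b. p i (n + i - l)) * d b = d a * (\<Prod>l=a+1..b. q i (n + i - l))"
      if "a \<le> b" "i \<le> a + 1"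
      using that(1) ab(2)
    proof (induction b rule: dec_induct)
      case (step b)
      have "(\<Prod>l=a+1..Suc b. p i (n + i - l)) * d (Suc b)
          = (\<Prod>l=a+1..b. p i (n + i - l)) * (p i (n + i - Suc b) * d (Suc b))"
        using step.hyps by (simp add: mult_ac)
      also have "\<dots> = ((\<Prod>l=a+1..b. p i (n + i - l)) * d b) * q i (n + i - Suc b)"
        using step.hyps step.prems that(2) i pq[of i "Suc b"] by (simp add: mult_ac)
      also have "\<dots> = d a * (\<Prod>l=a+1..Suc b. q i (n + i - l))"
        using step by (simp add: mult_ac)
      finally show ?case .
    qed simp
    then show "(Rmat n p i * diagm n d) $$ (a, b) = (diagm n d * Rmat n q i) $$ (a, b)"
      using ab i by (auto simp: mult_diagm_entry Rmat_entry simp del: index_mult_mat(1))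
  qed auto
qed auto

text \<open>The closed form of part a), and likewise \<open>twist\<close> for part b), is set up
  over any field and for any parameters, because the induction on the size applies it to shifted
  parameters.\<close>

definition bz :: "nat \<Rightarrow> (nat \<Rightarrow> nat \<Rightarrow> 'a::field) \<Rightarrow> nat \<Rightarrow> nat \<Rightarrow> 'a" where
  "bz n t i j = (let j' = n + 1 - j in
     1 / t i (i + j') * (\<Prod>k=1..<i. t k (i + j' - 1) / t k (i + j')))"

definition twist :: "nat \<Rightarrow> (nat \<Rightarrow> nat \<Rightarrow> 'a::field) \<Rightarrow> 'a mat" where
  "twist n t = mat_sum n
     (\<lambda>i. ((\<Prod>j=i+1..n. t i j) / (\<Prod>k=1..<i. t k i)) \<cdot>\<^sub>m munit n i i) {1..n}"

lemma twist_eq_diagm: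
  "twist n t = diagm n (\<lambda>a. (\<Prod>j=a+2..n. t (a+1) j) / (\<Prod>k=1..<a+1. t k (a+1)))"
proof (rule eq_matI)
  let ?c = "\<lambda>i. (\<Prod>j=i+1..n. t i j) / (\<Prod>k=1..<i. t k i)"
  fix a b assume "a < dim_row (diagm n (\<lambda>a. (\<Prod>j=a+2..n. t (a+1) j) / (\<Prod>k=1..<a+1. t k (a+1))))"
    "b < dim_col (diagm n (\<lambda>a. (\<Prod>j=a+2..n. t (a+1) j) / (\<Prod>k=1..<a+1. t k (a+1))))"
  then have ab: "a < n" "b < n" by auto
  have "twist n t $$ (a, b) = (\<Sum>i=1..n. (?c i \<cdot>\<^sub>m munit n i i) $$ (a, b))"
    using ab by (simp add: twist_def mat_sum_def)
  also have "\<dots> = (\<Sum>i=1..n. if i = Suc a then if a = b then ?c i else 0 else 0)"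
    using ab by (intro sum.cong) (auto simp: munit_def)
  also have "\<dots> = (if a = b then ?c (Suc a) else 0)"
    using ab by simp
  finally show "twist n t $$ (a, b)
      = diagm n (\<lambda>a. (\<Prod>j=a+2..n. t (a+1) j) / (\<Prod>k=1..<a+1. t k (a+1))) $$ (a, b)"
    using ab by (simp add: diagm_def)
qed (auto simp: twist_def mat_sum_def)

text \<open>The two products of quotients differ only by the factor \<open>k = 1\<close> of the
  longer one, which is \<open>t 1 (l + 1) / t 1 (l + 2)\<close>. The equation has the shape required
  by \<open>Xmat_scale\<close> for the diagonal \<open>1 / t 1 (a + 2)\<close>.\<close>

lemma bz_shift:
  fixes t :: "nat \<Rightarrow> nat \<Rightarrow> 'a::field"
  assumes nz: "\<And>i j. 1 \<le> i \<Longrightarrow> i < j \<Longrightarrow> j \<le> Suc m \<Longrightarrow> t i j \<noteq> 0"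
    and i: "1 \<le> i" "i \<le> l" "l < m"
  shows "bz m (shift t) i (m + i - l) / t 1 (l + 2)
    = shift (bz (Suc m) t) i (m + i - l) / t 1 (l + 1)"
proof -
  have e: "m + 1 - (m + i - l) = Suc l - i" "Suc m + 1 - Suc (m + i - l) = Suc l - i"
    "i + (Suc l - i) = Suc l" "Suc i + (Suc l - i) = Suc (Suc l)"
    using i by auto
  have "(\<Prod>k=1..<Suc i. t k (Suc l) / t k (Suc (Suc l)))
      = t 1 (Suc l) / t 1 (Suc (Suc l)) * (\<Prod>k=Suc 1..<Suc i. t k (Suc l) / t k (Suc (Suc l)))"
    using i by (simp add: prod.atLeast_Suc_lessThan del: prod.op_ivl_Suc)
  also have "(\<Prod>k=Suc 1..<Suc i. t k (Suc l) / t k (Suc (Suc l)))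
      = (\<Prod>k=1..<i. t (Suc k) (Suc l) / t (Suc k) (Suc (Suc l)))"
    by (simp only: prod.shift_bounds_Suc_ivl)
  finally show ?thesis
    using nz[of 1 "Suc l"] i unfolding bz_def shift_def e Let_def by (simp add: mult_ac)
qed

text \<open>With the partial products \<open>D\<close> of the first row of \<open>t\<close>, the
  entries of both unipotent factors become quotients of values of \<open>D\<close>. Both sides then
  have the entry \<open>(- 1) ^ a * D (m - a) / D c\<close> at (a, c) if \<open>a + c <= m\<close>,
  and 0 otherwise.\<close>

lemma Rmat_mult_w0bar:
  fixes t :: "nat \<Rightarrow> nat \<Rightarrow> 'a::field"
  assumes nz: "\<And>j. 1 < j \<Longrightarrow> j \<le> Suc m \<Longrightarrow> t 1 j \<noteq> 0"
  defines "D \<equiv> \<lambda>a. \<Prod>l=1..a. t 1 (l + 1)"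
  shows "Rmat (Suc m) (\<lambda>i j. - t i j) 1 * w0bar (Suc m)
    = four_block_mat (mat 1 1 (\<lambda>_. D m)) (0\<^sub>m 1 m) (mat m 1 (\<lambda>(a, _). (- 1) ^ (a + 1) * D (m - 1 - a)))
        (w0bar m * diagm m (\<lambda>a. 1 / t 1 (a + 2))) * Rmat (Suc m) (bz (Suc m) t) 1"
    (is "?L = ?B * ?U")
proof (rule eq_matI)
  have D0: "D a \<noteq> 0" if "a \<le> m" for a
    using that nz by (auto simp: D_def)
  have D_Suc: "D (Suc a) = D a * t 1 (a + 2)" for a
    by (simp add: D_def)
  \<comment> \<open>In the first row of the transform the product of quotients is empty: position
    \<open>k\<close> carries \<open>1 / t 1 (k + 1)\<close>.\<close>
  have U: "?U $$ (l, c) = (if l \<le> c then D l / D c else 0)" if "l < Suc m" "c < Suc m" for l c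
  proof -
    have "(\<Prod>k=l+1..c. bz (Suc m) t 1 (Suc m + 1 - k)) = D l / D c" if "l \<le> c"
      using that \<open>c < Suc m\<close>
    proof (induction c rule: dec_induct)
      case base
      then show ?case using D0[of l] by simp
    next
      case (step c)
      then show ?case by (simp add: D_Suc bz_def)
    qed
    with that D0[of l] show ?thesis by (auto simp: Rmat_entry)
  qed
  \<comment> \<open>Here position \<open>k\<close> carries \<open>- t 1 (m + 2 - k)\<close>, so the
    partial products run through the row from its far end.\<close>
  have R: "Rmat (Suc m) (\<lambda>i j. - t i j) 1 $$ (a, l)
      = (if a \<le> l then (- 1) ^ (a + l) * D (m - a) / D (m - l) else 0)" if "a < Suc m" "l < Suc m" for a l
  proof -
    have "(\<Prod>k=a+1..l. - t 1 (Suc m + 1 - k)) = (- 1) ^ (a + l) * D (m - a) / D (m - l)" if "a \<le> l"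
      using that \<open>l < Suc m\<close>
    proof (induction l rule: dec_induct)
      case base
      then show ?case using D0[of "m - a"] by (simp flip: mult_2 add: power_mult)
    next
      case (step l)
      have e: "Suc m - l = Suc (m - l)"
        using step.prems by simp
      have "D (m - l) = D (m - Suc l) * t 1 (Suc m - l)"
        using D_Suc[of "m - Suc l"] step.prems by (simp add: Suc_diff_Suc e)
      then show ?case using step D0[of "m - Suc l"] nz[of "Suc m - l"] by (simp add: e)
    qed
    with that D0[of "m - a"] show ?thesis by (auto simp: Rmat_entry simp flip: mult_2 simp: power_mult)
  qed
  fix a c assume "a < dim_row (?B * ?U)" "c < dim_col (?B * ?U)"
  then have ac: "a < Suc m" "c < Suc m" by auto
  have "?L $$ (a, c) = (\<Sum>l<Suc m. Rmat (Suc m) (\<lambda>i j. - t i j) 1 $$ (a, l) * w0bar (Suc m) $$ (l, c))"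
    using ac by (intro mult_entry) auto
  also have "\<dots> = (\<Sum>l<Suc m. if l = m - c then
      Rmat (Suc m) (\<lambda>i j. - t i j) 1 $$ (a, l) * (- 1) ^ l else 0)"
    using ac by (intro sum.cong) (auto simp: w0bar_entry)
  also have "\<dots> = (if a + c \<le> m then (- 1) ^ a * D (m - a) / D c else 0)"
  proof -
    have "(- 1) ^ (a + (m - c)) * (- 1) ^ (m - c) = ((- 1) ^ a :: 'a)"
      by (simp add: power_add mult.assoc flip: power_mult_distrib)
    then show ?thesis
      using ac by (auto simp: R simp del: One_nat_def sum.lessThan_Suc)
  qed
  finally have L: "?L $$ (a, c) = (if a + c \<le> m then (- 1) ^ a * D (m - a) / D c else 0)" .
  \<comment> \<open>Besides column 0, a row \<open>a > 0\<close> has its only nonzero entry in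
    column \<open>Suc m - a\<close>, from the antidiagonal block. The two contributions cancel as
    soon as \<open>a + c > m\<close>.\<close>
  have B: "?B $$ (a, l) = (if l = 0 then (- 1) ^ a * D (m - a) else 0)
      + (if l = Suc m - a then if a = 0 then 0 else - ((- 1) ^ a) / t 1 (l + 1) else 0)"
    if "l < Suc m" for l
  proof (cases "a = 0 \<or> l = 0")
    case True
    show ?thesis
    proof (cases a)
      case 0
      with that show ?thesis by simp
    next
      case (Suc a')
      with True that ac show ?thesis by simp
    qed
  next
    case False
    then obtain a' l' where "a = Suc a'" "l = Suc l'" by (metis not0_implies_Suc)
    with that ac show ?thesis
      by (auto simp: mult_diagm_entry w0bar_entry simp del: index_mult_mat(1))
  qed
  define u where "u l = ?U $$ (l, c)" for l
  have u: "u l = (if l \<le> c then D l / D c else 0)" if "l < Suc m" for l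
    using that ac by (simp only: u_def U)
  have "?B \<in> carrier_mat (Suc m) (Suc m)"
    by (intro carrier_matI) simp_all
  then have "(?B * ?U) $$ (a, c) = (\<Sum>l<Suc m. ?B $$ (a, l) * u l)"
    unfolding u_def using ac by (rule mult_entry[OF _ Rmat_carrier])
  also have "\<dots> = (\<Sum>l<Suc m. (if l = 0 then (- 1) ^ a * D (m - a) * u l else 0)
      + (if l = Suc m - a then if a = 0 then 0 else - ((- 1) ^ a) / t 1 (l + 1) * u l else 0))"
    by (intro sum.cong[OF refl], subst B) (simp_all add: left_diff_distrib)
  also have "\<dots> = (if a + c \<le> m then (- 1) ^ a * D (m - a) / D c else 0)"
  proof (cases "a = 0")
    case True
    have "D 0 = 1" by (simp add: D_def)
    with True ac show ?thesis by (simp add: u del: sum.lessThan_Suc)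
  next
    case False
    have D: "D (Suc m - a) = D (m - a) * t 1 (Suc m - a + 1)" "Suc m - a \<le> m"
      using D_Suc[of "m - a"] ac False by (simp_all add: Suc_diff_le)
    have "(\<Sum>l<Suc m. (if l = 0 then (- 1) ^ a * D (m - a) * u l else 0)
        + (if l = Suc m - a then if a = 0 then 0 else - ((- 1) ^ a) / t 1 (l + 1) * u l else 0))
      = (- 1) ^ a * D (m - a) * u 0 + - ((- 1) ^ a) / t 1 (Suc m - a + 1) * u (Suc m - a)"
      using False D(2) unfolding sum.distrib by (simp del: sum.lessThan_Suc)
    also have "\<dots> = (if a + c \<le> m then (- 1) ^ a * D (m - a) / D c else 0)"
      using False ac D D0[of c] nz[of "Suc m - a + 1"]
      by (auto simp: u D_def[THEN meta_eq_to_obj_eq, THEN fun_cong, of 0])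
    finally show ?thesis .
  qed
  finally show "?L $$ (a, c) = (?B * ?U) $$ (a, c)"
    using L by simp
qed auto

subsection \<open>Existence of the factorization\<close>

lemma twist_entry:
  "a < n \<Longrightarrow> b < n \<Longrightarrow> twist n t $$ (a, b)
    = (if a = b then (\<Prod>j=a+2..n. t (a+1) j) / (\<Prod>k=1..<a+1. t k (a+1)) else 0)"
  by (simp add: twist_eq_diagm diagm_def)

lemma twist_carrier [simp]: "twist n t \<in> carrier_mat n n"
  by (simp add: twist_def mat_sum_def)

lemma dim_twist [simp]: "dim_row (twist n t) = n" "dim_col (twist n t) = n"
  using twist_carrier by blast+

text \<open>Shifting loses from each denominator the factor belonging to the first row of
  \<open>t\<close>; the diagonal matrix on the right restores it. The corner is the numerator of the
  first entry, whose denominator is empty.\<close>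

lemma twist_Suc:
  fixes t :: "nat \<Rightarrow> nat \<Rightarrow> 'a::field"
  shows "twist (Suc m) t = four_block_mat (mat 1 1 (\<lambda>_. \<Prod>l=1..m. t 1 (l + 1))) (0\<^sub>m 1 m) (0\<^sub>m m 1)
    (twist m (shift t) * diagm m (\<lambda>a. 1 / t 1 (a + 2)))" (is "_ = ?B")
proof (rule eq_matI)
  fix a b assume "a < dim_row ?B" "b < dim_col ?B"
  then have ab: "a < Suc m" "b < Suc m" by auto
  have 1: "(\<Prod>j=Suc (Suc a)..Suc m. t i j) = (\<Prod>j=Suc a..m. t i (Suc j))" for i a
    by (simp only: prod.shift_bounds_cl_Suc_ivl)
  have 2: "(\<Prod>k=1..<Suc (Suc a). t k i) = t 1 i * (\<Prod>k=1..<Suc a. t (Suc k) i)" for i a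
  proof -
    have "(\<Prod>k=Suc 1..<Suc (Suc a). t k i) = (\<Prod>k=1..<Suc a. t (Suc k) i)"
      by (rule prod.shift_bounds_Suc_ivl)
    then show ?thesis
      by (simp add: prod.atLeast_Suc_lessThan del: prod.op_ivl_Suc)
  qed
  show "twist (Suc m) t $$ (a, b) = ?B $$ (a, b)"
  proof (cases "a = 0 \<or> b = 0")
    case True
    with ab 1[of 1 0] show ?thesis by (auto simp: twist_entry simp del: prod.cl_ivl_Suc)
  next
    case False
    then obtain a' b' where "a = Suc a'" "b = Suc b'" by (metis not0_implies_Suc)
    with ab 1[of "Suc (Suc a')" "Suc a'"] 2[of "Suc (Suc a')" a'] show ?thesis
      by (auto simp: twist_entry mult_diagm_entry[OF twist_carrier] shift_def mult_ac
          simp del: index_mult_mat(1) prod.op_ivl_Suc prod.cl_ivl_Suc)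
  qed
qed auto

lemma block1_eq: "A \<in> carrier_mat m m \<Longrightarrow> block1 A = four_block_mat (1\<^sub>m 1) (0\<^sub>m 1 m) (0\<^sub>m m 1) A"
  by (auto simp: block1_def)

lemma mult_block_lower:
  fixes A A' :: "'a::comm_ring_1 mat"
  assumes "A \<in> carrier_mat k k" "C \<in> carrier_mat m k" "D \<in> carrier_mat m m"
    and "A' \<in> carrier_mat k k" "C' \<in> carrier_mat m k" "D' \<in> carrier_mat m m"
  shows "four_block_mat A (0\<^sub>m k m) C D * four_block_mat A' (0\<^sub>m k m) C' D'
    = four_block_mat (A * A') (0\<^sub>m k m) (C * A' + D * C') (D * D')"
proof -
  have "A * A' \<in> carrier_mat k k" "D * D' \<in> carrier_mat m m"
    using assms by auto
  then show ?thesis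
    using assms by (subst mult_four_block_mat[of _ k k _ m _ m _ _ k _ m]) auto
qed

text \<open>Peeling off one factor reduces size \<open>m + 1\<close> and parameters \<open>t\<close>
  to size \<open>m\<close> and \<open>shift t\<close>; empty matrices form the base case.\<close>

lemma BZ_factorization_bz:
  fixes t :: "nat \<Rightarrow> nat \<Rightarrow> 'a::field"
  assumes nz: "\<And>i j. 1 \<le> i \<Longrightarrow> i < j \<Longrightarrow> j \<le> n \<Longrightarrow> t i j \<noteq> 0"
  shows "\<exists>Y. BZ_factorization n t Y (twist n t) (bz n t)"
  using nz
proof (induction n arbitrary: t)
  case 0
  show ?case
    by (intro exI[of _ "1\<^sub>m 0"])
      (auto simp: BZ_factorization_def lower_unipotent_def diagonal_mat_def twist_eq_diagm intro: eq_matI)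
next
  case (Suc m)
  have nz': "shift t i j \<noteq> 0" if "1 \<le> i" "i < j" "j \<le> m" for i j
    using that Suc.prems[of "Suc i" "Suc j"] by (simp add: shift_def)
  obtain Y' where Y': "BZ_factorization m (shift t) Y' (twist m (shift t)) (bz m (shift t))"
    using Suc.IH[of "shift t", OF nz'] by auto
  define X' where "X' = Xmat m (\<lambda>i j. - shift t i j)"
  define T' where "T' = twist m (shift t)"
  define G where "G = diagm m (\<lambda>a. 1 / t 1 (a + 2))"
  define P where "P = Xmat m (bz m (shift t))"
  define Q where "Q = Xmat m (shift (bz (Suc m) t))"
  define d where "d = (\<Prod>l=1..m. t 1 (l + 1))"
  define d1 where "d1 = mat 1 1 (\<lambda>_::nat \<times> nat. d)"
  define c where "c = mat m 1 (\<lambda>(a, _::nat). (- 1) ^ (a + 1) * (\<Prod>l=1..m - 1 - a. t 1 (l + 1)))"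
  \<comment> \<open>The lower left block is forced: multiplied by the corner \<open>d\<close> it
    must give \<open>X' * c\<close>.\<close>
  define Y where "Y = four_block_mat (1\<^sub>m 1) (0\<^sub>m 1 m) (inverse d \<cdot>\<^sub>m (X' * c)) Y'"
  have carr [simp]: "X' \<in> carrier_mat m m" "Y' \<in> carrier_mat m m" "T' \<in> carrier_mat m m"
    "G \<in> carrier_mat m m" "P \<in> carrier_mat m m" "Q \<in> carrier_mat m m"
    "c \<in> carrier_mat m 1" "d1 \<in> carrier_mat 1 1"
    using Y' by (auto simp: BZ_factorization_def X'_def T'_def G_def P_def Q_def c_def d1_def)
  have carr' [simp]: "Y' * T' \<in> carrier_mat m m" "w0bar m * G \<in> carrier_mat m m"
    "T' * G \<in> carrier_mat m m" "X' * c \<in> carrier_mat m 1"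
    "inverse d \<cdot>\<^sub>m (X' * c) \<in> carrier_mat m 1" "Y' * (T' * G) \<in> carrier_mat m m"
    by (auto intro!: mult_carrier_mat[of _ m m] smult_carrier_mat simp del: One_nat_def)
  have "d \<noteq> 0"
    using Suc.prems by (auto simp: d_def)
  then have cd: "inverse d \<cdot>\<^sub>m (X' * c) * d1 = X' * c"
    using carr by (intro eq_matI) (auto simp: d1_def scalar_prod_def)
  have "X' * w0bar m = Y' * T' * P"
    using Y' by (simp add: BZ_factorization_def X'_def T'_def P_def)
  moreover have "P * G = G * Q"
    unfolding P_def Q_def G_def
  proof (rule Xmat_scale)
    fix i l :: nat assume "1 \<le> i" "i \<le> l" "l < m"
    with bz_shift[of m t i l] Suc.prems
    show "bz m (shift t) i (m + i - l) * (1 / t 1 (l + 2))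
        = 1 / t 1 (l - 1 + 2) * shift (bz (Suc m) t) i (m + i - l)"
      by simp
  qed
  moreover have "X' * (w0bar m * G) = X' * w0bar m * G"
    by (rule assoc_mult_mat[symmetric]) (rule carr w0bar_carrier)+
  moreover have "Y' * T' * P * G = Y' * T' * (P * G)"
    by (rule assoc_mult_mat) (rule carr carr')+
  moreover have "Y' * T' * (G * Q) = Y' * T' * G * Q"
    by (rule assoc_mult_mat[symmetric]) (rule carr carr')+
  moreover have "Y' * T' * G = Y' * (T' * G)"
    by (rule assoc_mult_mat) (rule carr carr')+
  \<comment> \<open>This is the induction hypothesis multiplied by \<open>G\<close> on the right,
    after \<open>G\<close> has been carried to the left of \<open>P\<close>, which turns
    \<open>P\<close> into \<open>Q\<close>.\<close>
  ultimately have core: "X' * (w0bar m * G) = Y' * (T' * G) * Q"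
    by simp
  have "Xmat (Suc m) (\<lambda>i j. - t i j) * w0bar (Suc m)
      = block1 X' * (Rmat (Suc m) (\<lambda>i j. - t i j) 1 * w0bar (Suc m))"
    by (simp add: Xmat_Suc X'_def shift_def[abs_def] assoc_mult_mat[of _ "Suc m" "Suc m" _ "Suc m" _ "Suc m"])
  also have "Rmat (Suc m) (\<lambda>i j. - t i j) 1 * w0bar (Suc m)
      = four_block_mat d1 (0\<^sub>m 1 m) c (w0bar m * G) * Rmat (Suc m) (bz (Suc m) t) 1"
    unfolding d1_def d_def c_def G_def by (rule Rmat_mult_w0bar) (use Suc.prems in auto)
  also have "block1 X' * (four_block_mat d1 (0\<^sub>m 1 m) c (w0bar m * G) * Rmat (Suc m) (bz (Suc m) t) 1)
      = block1 X' * four_block_mat d1 (0\<^sub>m 1 m) c (w0bar m * G) * Rmat (Suc m) (bz (Suc m) t) 1"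
    using four_block_carrier_mat[OF carr(8) carr'(2)]
    by (intro assoc_mult_mat[symmetric, of _ "Suc m" "Suc m" _ "Suc m" _ "Suc m"]) auto
  also have "block1 X' * four_block_mat d1 (0\<^sub>m 1 m) c (w0bar m * G)
      = four_block_mat d1 (0\<^sub>m 1 m) (X' * c) (Y' * (T' * G) * Q)"
    unfolding block1_eq[OF carr(1)] mult_block_lower[OF one_carrier_mat zero_carrier_mat carr(1) carr(8,7) carr'(2)]
    by (simp add: core left_add_zero_mat[OF carr'(4)] left_mult_zero_mat[OF carr(8)] left_mult_one_mat[OF carr(8)]
        del: One_nat_def)
  also have "\<dots> = Y * four_block_mat d1 (0\<^sub>m 1 m) (0\<^sub>m m 1) (T' * G) * block1 Q"
    unfolding Y_def block1_eq[OF carr(6)]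
      mult_block_lower[OF one_carrier_mat carr'(5) carr(2) carr(8) zero_carrier_mat carr'(3)]
      right_mult_zero_mat[OF carr(2)] left_mult_one_mat[OF carr(8)] cd right_add_zero_mat[OF carr'(4)]
      mult_block_lower[OF carr(8) carr'(4,6) one_carrier_mat zero_carrier_mat carr(6)]
      right_mult_zero_mat[OF carr'(6)] right_mult_one_mat[OF carr(8)] right_mult_one_mat[OF carr'(4)]
      right_add_zero_mat[OF carr'(4)] ..
  also have "four_block_mat d1 (0\<^sub>m 1 m) (0\<^sub>m m 1) (T' * G) = twist (Suc m) t"
    by (simp add: twist_Suc d1_def d_def T'_def G_def)
  finally have eq: "Xmat (Suc m) (\<lambda>i j. - t i j) * w0bar (Suc m)
      = Y * twist (Suc m) t * block1 Q * Rmat (Suc m) (bz (Suc m) t) 1" .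
  have Y: "Y \<in> carrier_mat (Suc m) (Suc m)"
    unfolding Y_def using four_block_carrier_mat[of "1\<^sub>m 1" 1 1 Y' m m] by simp
  have "twist (Suc m) t \<in> carrier_mat (Suc m) (Suc m)"
    by (simp add: twist_eq_diagm)
  with Y have "Y * twist (Suc m) t * block1 Q * Rmat (Suc m) (bz (Suc m) t) 1
      = Y * twist (Suc m) t * Xmat (Suc m) (bz (Suc m) t)"
    unfolding Xmat_Suc Q_def
    by (intro assoc_mult_mat[of _ "Suc m" "Suc m" _ "Suc m" _ "Suc m"]) auto
  moreover have "lower_unipotent Y"
  proof -
    have "lower_unipotent Y'" "dim_row Y' = m" "dim_col Y' = m"
      using Y' carrier_matD[OF carr(2)] by (auto simp: BZ_factorization_def)
    then show ?thesis by (auto simp: lower_unipotent_def Y_def)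
  qed
  moreover have "diagonal_mat (twist (Suc m) t)"
    by (simp add: twist_eq_diagm diagonal_mat_def diagm_def)
  ultimately show ?case
    using Y eq by (intro exI[of _ Y]) (simp add: BZ_factorization_def twist_eq_diagm)
qed

subsection \<open>Uniqueness of the factorization\<close>

text \<open>Elimination order: once the rows of \<open>U\<close> above row \<open>i\<close> are
  known, the entries of \<open>L\<close> left of the diagonal in row \<open>i\<close> follow from
  left to right by dividing by the pivots, and then row \<open>i\<close> of \<open>U\<close> follows
  because \<open>L\<close> has ones on its diagonal.\<close>

lemma LU_unique:
  fixes L L' U U' :: "'a::field mat"
  assumes c: "L \<in> carrier_mat n n" "L' \<in> carrier_mat n n" "U \<in> carrier_mat n n" "U' \<in> carrier_mat n n"
    and L: "lower_unipotent L" "lower_unipotent L'"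
    and U: "upper_triangular U" "upper_triangular U'"
    and nz: "\<And>i. i < n \<Longrightarrow> U $$ (i, i) \<noteq> 0"
    and eq: "L * U = L' * U'"
  shows "U = U'"
proof (rule eq_matI)
  have sum_eq: "(\<Sum>k<n. L $$ (i, k) * U $$ (k, j)) = (\<Sum>k<n. L' $$ (i, k) * U' $$ (k, j))"
    if "i < n" "j < n" for i j
    using eq that by (simp only: mult_entry[OF c(1,3) that, symmetric] mult_entry[OF c(2,4) that, symmetric])
  have rows: "\<forall>j<n. U $$ (i, j) = U' $$ (i, j)" if "i < n" for i
    using that
  proof (induction i rule: less_induct)
    case (less i)
    then have IH: "U $$ (y, j) = U' $$ (y, j)" if "y < i" "j < n" for y j
      using that by simp
    have Lij: "L $$ (i, j) = L' $$ (i, j)" if "j < i" for j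
      using that
    proof (induction j rule: less_induct)
      case (less j)
      have split: "(\<Sum>k<n. A $$ (i, k) * B $$ (k, j)) = (\<Sum>k<j. A $$ (i, k) * B $$ (k, j)) + A $$ (i, j) * B $$ (j, j)"
        if "upper_triangular B" "B \<in> carrier_mat n n" for A B :: "'a mat"
      proof -
        have "(\<Sum>k<n. A $$ (i, k) * B $$ (k, j)) = (\<Sum>k<Suc j. A $$ (i, k) * B $$ (k, j))"
          using that less.prems \<open>i < n\<close>
          by (intro sum.mono_neutral_right) (auto simp: upper_triangular_def)
        then show ?thesis by simp
      qed
      have "(\<Sum>k<j. L $$ (i, k) * U $$ (k, j)) = (\<Sum>k<j. L' $$ (i, k) * U' $$ (k, j))"
        using less.prems less.IH \<open>i < n\<close> IH by (intro sum.cong) simp_all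
      then have "L $$ (i, j) * U $$ (j, j) = L' $$ (i, j) * U' $$ (j, j)"
        using sum_eq[of i j] split[OF U(1) c(3)] split[OF U(2) c(4)] less.prems \<open>i < n\<close> by simp
      moreover have "U' $$ (j, j) = U $$ (j, j)" "U $$ (j, j) \<noteq> 0"
        using less.prems \<open>i < n\<close> nz[of j] IH[of j j] by simp_all
      ultimately show ?case by simp
    qed
    show ?case
    proof (intro allI impI)
      fix j assume "j < n"
      have split: "(\<Sum>k<n. A $$ (i, k) * B $$ (k, j)) = (\<Sum>k<i. A $$ (i, k) * B $$ (k, j)) + B $$ (i, j)"
        if "lower_unipotent A" "A \<in> carrier_mat n n" for A B :: "'a mat"
      proof -
        have "(\<Sum>k<n. A $$ (i, k) * B $$ (k, j)) = (\<Sum>k<Suc i. A $$ (i, k) * B $$ (k, j))"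
          using that \<open>i < n\<close> by (intro sum.mono_neutral_right) (auto simp: lower_unipotent_def)
        with that \<open>i < n\<close> show ?thesis by (auto simp: lower_unipotent_def)
      qed
      have "(\<Sum>k<i. L $$ (i, k) * U $$ (k, j)) = (\<Sum>k<i. L' $$ (i, k) * U' $$ (k, j))"
        using IH Lij \<open>j < n\<close> by (intro sum.cong) simp_all
      then show "U $$ (i, j) = U' $$ (i, j)"
        using sum_eq[OF \<open>i < n\<close> \<open>j < n\<close>] split[OF L(1) c(1)] split[OF L(2) c(2)] by simp
    qed
  qed
  then show "U $$ (i, j) = U' $$ (i, j)" if "i < dim_row U'" "j < dim_col U'" for i j
    using that c by auto
qed (use c in auto)

section \<open>Unipotent upper triangular matrices\<close>

definition upper_unipotent :: "'a::zero_neq_one mat \<Rightarrow> bool" where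
  "upper_unipotent A \<longleftrightarrow> upper_triangular A \<and> (\<forall>i<dim_row A. A $$ (i, i) = 1)"

lemma upper_unipotent_mult:
  fixes A B :: "'a::comm_ring_1 mat"
  assumes c: "A \<in> carrier_mat n n" "B \<in> carrier_mat n n" and u: "upper_unipotent A" "upper_unipotent B"
  shows "upper_unipotent (A * B)"
proof -
  have ut: "A $$ (i, k) * B $$ (k, j) = (if i = j \<and> k = i then 1 else 0)"
    if "j \<le> i" "i < n" "k < n" for i j k
  proof -
    consider "k < i" | "j < k" | "k = i" "j = i" using \<open>j \<le> i\<close> by linarith
    then show ?thesis
      using that c u by cases (auto simp: upper_unipotent_def upper_triangular_def)
  qed
  have "(A * B) $$ (i, j) = (if i = j then 1 else 0)" if "j \<le> i" "i < n" for i j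
  proof -
    have "(A * B) $$ (i, j) = (\<Sum>k<n. A $$ (i, k) * B $$ (k, j))"
      using that c by (intro mult_entry) auto
    also have "\<dots> = (\<Sum>k<n. if k = i then if i = j then 1 else 0 else 0)"
      using that by (intro sum.cong) (simp_all add: ut)
    finally show ?thesis using that by simp
  qed
  then show ?thesis
    using c by (simp add: upper_unipotent_def upper_triangular_def del: index_mult_mat(1))
qed

lemma upper_unipotent_Rmat: "1 \<le> i \<Longrightarrow> i \<le> n \<Longrightarrow> upper_unipotent (Rmat n t i)"
  by (simp add: upper_unipotent_def upper_triangular_def Rmat_entry)

lemma upper_unipotent_block1:
  assumes "A \<in> carrier_mat m m" "upper_unipotent A"
  shows "upper_unipotent (block1 A)"
proof -
  have "dim_row A = m" "dim_col A = m" using assms by auto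
  with assms show ?thesis
    by (auto simp: upper_unipotent_def upper_triangular_def block1_def)
qed

lemma upper_unipotent_Xmat: "upper_unipotent (Xmat n t :: 'a::comm_ring_1 mat)"
proof (induction n arbitrary: t)
  case 0
  show ?case by (simp add: upper_unipotent_def upper_triangular_def)
next
  case (Suc m)
  show ?case
    unfolding Xmat_Suc
    by (rule upper_unipotent_mult[OF block1_carrier[OF Xmat_carrier] Rmat_carrier
          upper_unipotent_block1[OF Xmat_carrier Suc.IH] upper_unipotent_Rmat]) simp_all
qed

text \<open>Column \<open>j\<close> of a product with \<open>R\<close> is column \<open>j\<close> of
  the left factor plus a combination of its earlier columns, so the columns can be recovered one
  after the other.\<close>

lemma upper_unipotent_cancel_right:
  fixes A B R :: "'a::comm_ring_1 mat"
  assumes c: "A \<in> carrier_mat n n" "B \<in> carrier_mat n n" "R \<in> carrier_mat n n"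
    and R: "upper_unipotent R" and eq: "A * R = B * R"
  shows "A = B"
proof -
  have split: "(C * R) $$ (i, j) = (\<Sum>k<j. C $$ (i, k) * R $$ (k, j)) + C $$ (i, j)"
    if "C \<in> carrier_mat n n" "i < n" "j < n" for C i j
  proof -
    have "(C * R) $$ (i, j) = (\<Sum>k<n. C $$ (i, k) * R $$ (k, j))"
      using that c by (intro mult_entry) simp_all
    also have "\<dots> = (\<Sum>k<Suc j. C $$ (i, k) * R $$ (k, j))"
      using that c R by (intro sum.mono_neutral_right) (auto simp: upper_unipotent_def upper_triangular_def)
    also have "\<dots> = (\<Sum>k<j. C $$ (i, k) * R $$ (k, j)) + C $$ (i, j)"
      using that c R by (simp add: upper_unipotent_def)
    finally show ?thesis .
  qed
  have "A $$ (i, j) = B $$ (i, j)" if "i < n" "j < n" for i j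
    using that(2)
  proof (induction j rule: less_induct)
    case (less j)
    then have "(\<Sum>k<j. A $$ (i, k) * R $$ (k, j)) = (\<Sum>k<j. B $$ (i, k) * R $$ (k, j))"
      by (intro sum.cong) simp_all
    then show ?case
      using split[OF c(1) \<open>i < n\<close> less.prems] split[OF c(2) \<open>i < n\<close> less.prems]
      by (simp add: eq del: index_mult_mat(1))
  qed
  then show ?thesis using c by (intro eq_matI) simp_all
qed

section \<open>Recovering the parameters from the matrix X\<close>

lemma block1_inject:
  assumes "A \<in> carrier_mat m m" "B \<in> carrier_mat m m" "block1 A = block1 B"
  shows "A = B"
proof (rule eq_matI)
  fix i j assume "i < dim_row B" "j < dim_col B"
  with assms(1,2) arg_cong[OF assms(3), of "\<lambda>M. M $$ (Suc i, Suc j)"]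
  show "A $$ (i, j) = B $$ (i, j)" by (simp add: block1_def)
qed (use assms in auto)

text \<open>The first row of the bordered factor is that of the identity, so only the last factor
  contributes.\<close>

lemma Xmat_row_0:
  fixes p :: "nat \<Rightarrow> nat \<Rightarrow> 'a::comm_ring_1"
  assumes "c < Suc m"
  shows "Xmat (Suc m) p $$ (0, c) = (\<Prod>l=1..c. p 1 (Suc m + 1 - l))"
proof -
  have "Xmat (Suc m) p $$ (0, c)
      = (\<Sum>l<Suc m. block1 (Xmat m (shift p)) $$ (0, l) * Rmat (Suc m) p 1 $$ (l, c))"
    unfolding Xmat_Suc by (rule mult_entry[OF block1_carrier[OF Xmat_carrier] Rmat_carrier]) (use assms in simp_all)
  also have "\<dots> = (\<Sum>l<Suc m. if l = 0 then Rmat (Suc m) p 1 $$ (0, c) else 0)"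
    by (intro sum.cong) (auto simp: block1_def)
  also have "\<dots> = Rmat (Suc m) p 1 $$ (0, c)"
    by (simp del: sum.lessThan_Suc)
  finally show ?thesis
    using assms by (auto simp: Rmat_entry)
qed

text \<open>The first row consists of the partial products of the parameters of the last factor,
  so these parameters can be read off when none of them vanishes.\<close>

lemma Xmat_inject:
  fixes p q :: "nat \<Rightarrow> nat \<Rightarrow> 'a::field"
  assumes "\<And>i j. 1 \<le> i \<Longrightarrow> i < j \<Longrightarrow> j \<le> n \<Longrightarrow> p i j \<noteq> 0" and "Xmat n p = Xmat n q"
    and "1 \<le> i" "i < j" "j \<le> n"
  shows "p i j = q i j"
  using assms
proof (induction n arbitrary: p q i j)
  case 0
  then show ?case by simp
next
  case (Suc m)
  have prod_eq: "(\<Prod>l=1..c. p 1 (Suc m + 1 - l)) = (\<Prod>l=1..c. q 1 (Suc m + 1 - l))" if "c < Suc m" for c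
    using Xmat_row_0[OF that, of p] Xmat_row_0[OF that, of q] Suc.prems(2) by simp
  have first: "p 1 (Suc m + 1 - l) = q 1 (Suc m + 1 - l)" if "1 \<le> l" "l \<le> m" for l
  proof -
    obtain k where k: "l = Suc k" using \<open>1 \<le> l\<close> by (cases l) simp_all
    have nz: "(\<Prod>l=1..k. p 1 (Suc m + 1 - l)) \<noteq> 0"
      using Suc.prems(1)[of 1] that k by auto
    have "(\<Prod>l=1..k. p 1 (Suc m + 1 - l)) * p 1 (Suc m + 1 - l)
        = (\<Prod>l=1..k. p 1 (Suc m + 1 - l)) * q 1 (Suc m + 1 - l)"
      using prod_eq[of k] prod_eq[of l] that k by simp
    with nz show ?thesis by (simp only: mult_cancel_left) simp
  qed
  have R: "Rmat (Suc m) p 1 = Rmat (Suc m) q 1"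
  proof (rule eq_matI)
    fix a b assume "a < dim_row (Rmat (Suc m) q 1)" "b < dim_col (Rmat (Suc m) q 1)"
    then have ab: "a < Suc m" "b < Suc m" by simp_all
    then have "(\<Prod>l=a+1..b. p 1 (Suc m + 1 - l)) = (\<Prod>l=a+1..b. q 1 (Suc m + 1 - l))"
      using first by (intro prod.cong) simp_all
    with ab show "Rmat (Suc m) p 1 $$ (a, b) = Rmat (Suc m) q 1 $$ (a, b)"
      by (simp add: Rmat_entry)
  qed simp_all
  \<comment> \<open>The last factors agree and are unipotent, hence cancel on the right.\<close>
  have "block1 (Xmat m (shift p)) = block1 (Xmat m (shift q))"
    using Suc.prems(2) unfolding Xmat_Suc R
    by (intro upper_unipotent_cancel_right[OF block1_carrier[OF Xmat_carrier] block1_carrier[OF Xmat_carrier] Rmat_carrier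
          upper_unipotent_Rmat]) simp_all
  then have rest: "Xmat m (shift p) = Xmat m (shift q)"
    by (rule block1_inject[OF Xmat_carrier Xmat_carrier])
  show ?case
  proof (cases "i = 1")
    case True
    with first[of "Suc m + 1 - j"] Suc.prems(3-5) show ?thesis by simp
  next
    case False
    then obtain i' j' where ij: "i = Suc i'" "j = Suc j'"
      using Suc.prems(3,4) by (cases i; cases j) auto
    have "shift p i' j' = shift q i' j'"
    proof (rule Suc.IH[OF _ rest])
      show "shift p a b \<noteq> 0" if "1 \<le> a" "a < b" "b \<le> m" for a b
        using Suc.prems(1)[of "Suc a" "Suc b"] that by (simp add: shift_def)
    qed (use ij False Suc.prems(3-5) in auto)
    then show ?thesis by (simp add: shift_def ij)
  qed
qed

lemma bz_nonzero:
  fixes t :: "nat \<Rightarrow> nat \<Rightarrow> 'a::field"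
  assumes nz: "\<And>i j. 1 \<le> i \<Longrightarrow> i < j \<Longrightarrow> j \<le> n \<Longrightarrow> t i j \<noteq> 0" and "1 \<le> i" "i < j" "j \<le> n"
  shows "bz n t i j \<noteq> 0"
proof -
  have "(\<Prod>k=1..<i. t k (i + (n + 1 - j) - 1) / t k (i + (n + 1 - j))) \<noteq> 0"
    unfolding prod_zero_iff[OF finite_atLeastLessThan] using assms by auto
  moreover have "t i (i + (n + 1 - j)) \<noteq> 0"
    using assms by auto
  ultimately show ?thesis by (simp add: bz_def Let_def)
qed

text \<open>Grouping the diagonal matrix with \<open>Xmat\<close> makes any factorization an LU
  decomposition, to be compared with the explicit one. Since \<open>Xmat\<close> has unit diagonal,
  the diagonals of the upper factors give \<open>T\<close>; dividing by them leaves equal matrices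
  \<open>Xmat\<close>, to which \<open>Xmat_inject\<close> applies.\<close>

lemma BZ_factorization_unique:
  fixes t :: "nat \<Rightarrow> nat \<Rightarrow> 'a::field"
  assumes nz: "\<And>i j. 1 \<le> i \<Longrightarrow> i < j \<Longrightarrow> j \<le> n \<Longrightarrow> t i j \<noteq> 0"
    and fact: "BZ_factorization n t Y T p"
  shows "T = twist n t" and "1 \<le> i \<Longrightarrow> i < j \<Longrightarrow> j \<le> n \<Longrightarrow> p i j = bz n t i j"
proof -
  define d where "d a = T $$ (a, a)" for a
  have T: "T = diagm n d"
    using fact by (intro eq_matI) (auto simp: BZ_factorization_def diagonal_mat_def diagm_def d_def)
  define e where "e a = (\<Prod>j=a+2..n. t (a+1) j) / (\<Prod>k=1..<a+1. t k (a+1))" for a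
  have tw: "twist n t = diagm n e"
    unfolding twist_eq_diagm e_def by simp
  have e: "e a \<noteq> 0" if "a < n" for a
  proof -
    have "(\<Prod>j=a+2..n. t (a+1) j) \<noteq> 0" "(\<Prod>k=1..<a+1. t k (a+1)) \<noteq> 0"
      using nz that by (simp_all add: prod_zero_iff del: prod.op_ivl_Suc)
    then show ?thesis by (simp add: e_def)
  qed
  have "\<exists>Y'. BZ_factorization n t Y' (twist n t) (bz n t)"
    by (rule BZ_factorization_bz) (rule nz)
  then obtain Y' where fact': "BZ_factorization n t Y' (twist n t) (bz n t)" ..
  have ut: "upper_triangular (diagm n f * Xmat n r)" for f r
    using upper_unipotent_Xmat[of n r]
    by (simp add: upper_triangular_def upper_unipotent_def mult_diagm_entry del: index_mult_mat(1))
  have X1: "Xmat n r $$ (a, a) = 1" if "a < n" for a and r :: "nat \<Rightarrow> nat \<Rightarrow> 'a"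
    using upper_unipotent_Xmat[of n r] that by (simp add: upper_unipotent_def)
  have Y: "Y \<in> carrier_mat n n" "Y' \<in> carrier_mat n n" "lower_unipotent Y" "lower_unipotent Y'"
    using fact fact' by (simp_all add: BZ_factorization_def)
  have "Y' * twist n t * Xmat n (bz n t) = Y * T * Xmat n p"
    using fact fact' by (simp only: BZ_factorization_def)
  then have "Y' * (diagm n e * Xmat n (bz n t)) = Y * (diagm n d * Xmat n p)"
    by (simp only: T tw assoc_mult_mat[OF Y(1) diagm_carrier Xmat_carrier]
        assoc_mult_mat[OF Y(2) diagm_carrier Xmat_carrier])
  \<comment> \<open>Nonzero pivots are known beforehand only for the explicit factorization, which
    is why it is placed first in \<open>LU_unique\<close>.\<close>
  moreover have "(diagm n e * Xmat n (bz n t)) $$ (a, a) \<noteq> 0" if "a < n" for a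
    using e[OF that] X1[OF that] by (simp only: mult_diagm_entry(2)[OF Xmat_carrier that that]) simp
  ultimately have "diagm n e * Xmat n (bz n t) = diagm n d * Xmat n p"
    by (intro LU_unique[OF Y(2,1) mult_carrier_mat[OF diagm_carrier Xmat_carrier]
          mult_carrier_mat[OF diagm_carrier Xmat_carrier] Y(4,3) ut ut])
  note eq = this
  have ent: "e a * Xmat n (bz n t) $$ (a, b) = d a * Xmat n p $$ (a, b)" if "a < n" "b < n" for a b
    using arg_cong[OF eq, of "\<lambda>M. M $$ (a, b)"] by (simp only: mult_diagm_entry(2)[OF Xmat_carrier that])
  have ed: "e a = d a" if "a < n" for a
    using ent[OF that that] that by (simp add: X1)
  show "T = twist n t"
    unfolding T tw using ed by (intro eq_matI) (simp_all add: diagm_def)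
  have nzb: "bz n t i j \<noteq> 0" if "1 \<le> i" "i < j" "j \<le> n" for i j
    by (rule bz_nonzero) (rule nz that | assumption)+
  have "Xmat n (bz n t) = Xmat n p"
  proof (rule eq_matI)
    fix a b assume "a < dim_row (Xmat n p)" "b < dim_col (Xmat n p)"
    then have ab: "a < n" "b < n" by simp_all
    then show "Xmat n (bz n t) $$ (a, b) = Xmat n p $$ (a, b)"
      using ent[OF ab] e[OF ab(1)] ed[OF ab(1)] by (metis mult_cancel_left)
  qed simp_all
  note X_eq = this
  show "p i j = bz n t i j" if "1 \<le> i" "i < j" "j \<le> n"
    by (rule sym, rule Xmat_inject[of n "bz n t" p]) (rule nzb X_eq that | assumption)+
qed

subsection \<open>The measure \<open>dx / x\<close> and triangular maps\<close>

text \<open>The Haar measure of the multiplicative group of positive reals, extended by zero to the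
  whole line.\<close>

definition haar :: "real measure" where
  "haar = density lborel (\<lambda>x. ennreal (indicator {0<..} x / x))"

lemma sets_haar [simp, measurable_cong]: "sets haar = sets borel"
  by (simp add: haar_def)

lemma space_haar [simp]: "space haar = UNIV"
  by (simp add: haar_def)

lemma sigma_finite_haar: "sigma_finite_measure haar"
proof -
  have "(\<lambda>x::real. ennreal (indicator {0<..} x / x)) \<in> borel_measurable lborel"
    by measurable
  then show ?thesis
    unfolding haar_def
    by (subst sigma_finite_measure.sigma_finite_iff_density_finite[OF sigma_finite_lborel]) auto
qed

interpretation haar: product_sigma_finite "\<lambda>_::'i. haar"
  by (simp add: product_sigma_finite_def sigma_finite_haar)

text \<open>It suffices to test intervals: the integral of \<open>1 / x\<close> from
  \<open>exp l\<close> to \<open>exp u\<close> is \<open>u - l\<close>.\<close>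

lemma distr_haar_ln: "lborel = distr haar borel (ln :: real \<Rightarrow> real)"
proof (rule lborel_eqI)
  fix l u :: real
  assume "\<And>b. b \<in> Basis \<Longrightarrow> l \<bullet> b \<le> u \<bullet> b"
  then have lu: "l \<le> u" by simp
  have "ln \<in> borel_measurable (borel :: real measure)"
    by measurable
  then have [measurable]: "ln -` {l<..<u} \<in> sets borel"
    by (rule measurable_sets_borel) simp
  have "emeasure (distr haar borel ln) (box l u) = emeasure haar (ln -` {l<..<u})"
  proof -
    have "ln \<in> borel_measurable haar"
      by measurable
    then show ?thesis
      by (subst emeasure_distr) (simp_all add: box_real)
  qed
  also have "\<dots> = (\<integral>\<^sup>+x. ennreal (indicator {0<..} x / x) * indicator (ln -` {l<..<u}) x \<partial>lborel)"
    unfolding haar_def by (rule emeasure_density) measurable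
  also have "\<dots> = (\<integral>\<^sup>+x. ennreal (indicator {0<..} x / x) * indicator {exp l..exp u} x \<partial>lborel)"
  proof (rule nn_integral_cong_AE)
    \<comment> \<open>The passage from the open to the closed interval ignores two endpoints, a null
      set, and at nonpositive \<open>x\<close> the density vanishes.\<close>
    have *: "x \<in> ln -` {l<..<u} \<longleftrightarrow> x \<in> {exp l..exp u}" if x: "x \<noteq> exp l" "x \<noteq> exp u" "0 < x" for x
    proof -
      obtain s where "x = exp s" using x(3) by (metis exp_ln)
      with x(1,2) show ?thesis by auto
    qed
    show "AE x in lborel. ennreal (indicator {0<..} x / x) * indicator (ln -` {l<..<u}) x
        = ennreal (indicator {0<..} x / x) * indicator {exp l..exp u} x"
      using AE_lborel_singleton[of "exp l"] AE_lborel_singleton[of "exp u"]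
    proof eventually_elim
      case (elim x)
      with * show ?case by (cases "0 < x") (simp_all add: indicator_def)
    qed
  qed
  also have "\<dots> = ennreal (ln (exp u) - ln (exp l))"
  proof (rule nn_integral_FTC_Icc)
    fix x assume "x \<in> {exp l..exp u}"
    then have "0 < x" using less_le_trans[OF exp_gt_zero[of l]] by simp
    then show "DERIV ln x :> indicator {0<..} x / x" "0 \<le> indicator {0<..} x / x"
      by (auto intro!: derivative_eq_intros)
  qed (use lu in auto)
  finally show "emeasure (distr haar borel ln) (box l u) = (\<Prod>b\<in>Basis. (u - l) \<bullet> b)"
    by (simp add: box_real)
qed simp

text \<open>The substitution \<open>x = exp s\<close> turns \<open>haar\<close> into Lebesgue
  measure.\<close>

lemma nn_integral_haar:
  assumes [measurable]: "f \<in> borel_measurable borel"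
  shows "(\<integral>\<^sup>+x. f x \<partial>haar) = (\<integral>\<^sup>+s. f (exp s) \<partial>lborel)"
proof -
  have "(\<integral>\<^sup>+s. f (exp s) \<partial>lborel) = (\<integral>\<^sup>+x. f (exp (ln x)) \<partial>haar)"
    by (subst distr_haar_ln, subst nn_integral_distr) auto
  also have "\<dots> = (\<integral>\<^sup>+x. ennreal (indicator {0<..} x / x) * f (exp (ln x)) \<partial>lborel)"
    unfolding haar_def by (subst nn_integral_density) auto
  also have "\<dots> = (\<integral>\<^sup>+x. ennreal (indicator {0<..} x / x) * f x \<partial>lborel)"
    by (intro nn_integral_cong) (auto split: split_indicator)
  also have "\<dots> = (\<integral>\<^sup>+x. f x \<partial>haar)"
    unfolding haar_def by (subst nn_integral_density) auto
  finally show ?thesis by simp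
qed

text \<open>In the logarithmic coordinate the map is the reflection sending \<open>s\<close> to
  \<open>ln c - s\<close>, which preserves Lebesgue measure.\<close>

lemma nn_integral_haar_inverse:
  assumes [measurable]: "f \<in> borel_measurable borel" and c: "0 < c"
  shows "(\<integral>\<^sup>+x. f (c / x) \<partial>haar) = (\<integral>\<^sup>+x. f x \<partial>haar)"
proof -
  have "exp (ln c + (-1) * s) = c / exp s" for s
    using c by (simp add: exp_diff)
  then have "(\<integral>\<^sup>+x. f (c / x) \<partial>haar) = (\<integral>\<^sup>+s. f (exp (ln c + (-1) * s)) \<partial>lborel)"
    by (subst nn_integral_haar) simp_all
  also have "\<dots> = (\<integral>\<^sup>+x. f x \<partial>haar)"
    using nn_integral_real_affine[of "\<lambda>s. f (exp s)" "-1" "ln c"] by (simp add: nn_integral_haar)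
  finally show ?thesis .
qed

section \<open>Triangular inversions of the positive orthant\<close>

definition recip_map :: "('i \<Rightarrow> ('i \<Rightarrow> real) \<Rightarrow> real) \<Rightarrow> 'i set \<Rightarrow> ('i \<Rightarrow> real) \<Rightarrow> 'i \<Rightarrow> real" where
  "recip_map g S x = (\<lambda>e\<in>S. g e x / x e)"

text \<open>
  The coefficient of a coordinate depends only on coordinates of smaller rank, so the map is
  triangular and each coordinate undergoes the inversion of a measure invariant under
  dilations and inversion.
\<close>

definition triangular :: "('i \<Rightarrow> nat) \<Rightarrow> ('i \<Rightarrow> ('i \<Rightarrow> real) \<Rightarrow> real) \<Rightarrow> 'i set \<Rightarrow> bool" where
  "triangular r g S \<longleftrightarrow>
     (\<forall>e\<in>S. \<forall>x y. (\<forall>d\<in>S. r d < r e \<longrightarrow> x d = y d) \<longrightarrow> g e x = g e y) \<and>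
     (\<forall>e\<in>S. \<forall>x. (\<forall>d\<in>S. 0 < x d) \<longrightarrow> 0 < g e x) \<and>
     (\<forall>e\<in>S. g e \<in> borel_measurable (\<Pi>\<^sub>M _\<in>S. haar))"

abbreviation orthant :: "'i set \<Rightarrow> ('i \<Rightarrow> real) set" where
  "orthant S \<equiv> \<Pi>\<^sub>E _\<in>S. {0<..}"

lemma triangular_dep:
  "triangular r g S \<Longrightarrow> e \<in> S \<Longrightarrow> (\<And>d. d \<in> S \<Longrightarrow> r d < r e \<Longrightarrow> x d = y d) \<Longrightarrow> g e x = g e y"
  unfolding triangular_def by blast

lemma triangular_pos:
  "triangular r g S \<Longrightarrow> e \<in> S \<Longrightarrow> (\<And>d. d \<in> S \<Longrightarrow> 0 < x d) \<Longrightarrow> 0 < g e x"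
  unfolding triangular_def by blast

lemma triangular_measurable:
  "triangular r g S \<Longrightarrow> e \<in> S \<Longrightarrow> g e \<in> borel_measurable (\<Pi>\<^sub>M _\<in>S. haar)"
  unfolding triangular_def by blast

lemma recip_map_measurable:
  assumes "triangular r g S"
  shows "recip_map g S \<in> (\<Pi>\<^sub>M _\<in>S. haar) \<rightarrow>\<^sub>M (\<Pi>\<^sub>M _\<in>S. haar)"
  unfolding recip_map_def
proof (rule measurable_restrict)
  fix e assume e: "e \<in> S"
  have [measurable]: "(\<lambda>x. x e) \<in> (\<Pi>\<^sub>M _\<in>S. haar) \<rightarrow>\<^sub>M borel"
    using measurable_component_singleton[OF e, of "\<lambda>_. haar"]
    by (simp add: measurable_cong_sets[OF refl sets_haar])
  note [measurable] = triangular_measurable[OF assms e]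
  show "(\<lambda>x. g e x / x e) \<in> (\<Pi>\<^sub>M _\<in>S. haar) \<rightarrow>\<^sub>M haar"
    by measurable
qed

text \<open>As \<open>e\<close> has maximal rank, no coefficient of an index in \<open>S\<close>
  sees the coordinate \<open>e\<close>. It can be filled with 1, a positive value, so that
  positivity and measurability carry over from the larger index set.\<close>

lemma triangular_subset:
  assumes tri: "triangular r g (insert e S)" and e: "\<forall>d\<in>S. r d \<le> r e" "e \<notin> S"
  shows "triangular r g S"
  unfolding triangular_def
proof (intro conjI ballI allI impI)
  fix d assume d: "d \<in> S"
  show "g d x = g d y" if "\<forall>d'\<in>S. r d' < r d \<longrightarrow> x d' = y d'" for x y
    using that d e by (intro triangular_dep[OF tri]) (auto simp: leD)
  have upd: "g d (x(e := 1)) = g d x" for x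
    using d e by (intro triangular_dep[OF tri]) (auto simp: leD)
  show "0 < g d x" if "\<forall>d'\<in>S. 0 < x d'" for x
  proof -
    have "0 < g d (x(e := 1))"
      using that d by (intro triangular_pos[OF tri]) auto
    then show ?thesis by (simp add: upd)
  qed
  have [measurable]: "(\<lambda>x. x(e := 1)) \<in> (\<Pi>\<^sub>M _\<in>S. haar) \<rightarrow>\<^sub>M (\<Pi>\<^sub>M _\<in>insert e S. haar)"
    by (rule measurable_fun_upd[where J = S]) auto
  have [measurable]: "g d \<in> borel_measurable (\<Pi>\<^sub>M _\<in>insert e S. haar)"
    using triangular_measurable[OF tri] d by auto
  have "(\<lambda>x. g d (x(e := 1))) \<in> borel_measurable (\<Pi>\<^sub>M _\<in>S. haar)"
    by measurable
  then show "g d \<in> borel_measurable (\<Pi>\<^sub>M _\<in>S. haar)"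
    by (simp add: upd)
qed

text \<open>A coordinate of maximal rank influences only its own image.\<close>

lemma recip_map_insert:
  assumes tri: "triangular r g (insert e S)" and e: "\<forall>d\<in>S. r d \<le> r e" "e \<notin> S"
  shows "recip_map g (insert e S) (x(e := v)) = (recip_map g S x)(e := g e x / v)"
proof (rule ext)
  fix d
  have "g d (x(e := v)) = g d x" if "d \<in> insert e S"
    using that e by (intro triangular_dep[OF tri]) (auto simp: leD)
  then show "recip_map g (insert e S) (x(e := v)) d = ((recip_map g S x)(e := g e x / v)) d"
    using e by (auto simp: recip_map_def)
qed

text \<open>Ranks are compared strictly, so \<open>g e\<close> does not see the coordinate
  \<open>e\<close> itself, which may again be set to 1.\<close>

lemma triangular_last:
  assumes tri: "triangular r g (insert e S)" and e: "e \<notin> S"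
  shows "(\<And>d. d \<in> S \<Longrightarrow> x d = y d) \<Longrightarrow> g e x = g e y"
    and "(\<And>d. d \<in> S \<Longrightarrow> 0 < x d) \<Longrightarrow> 0 < g e x"
proof -
  show "(\<And>d. d \<in> S \<Longrightarrow> x d = y d) \<Longrightarrow> g e x = g e y"
    by (rule triangular_dep[OF tri]) auto
  have "g e (x(e := 1)) = g e x"
    by (rule triangular_dep[OF tri]) auto
  moreover have "0 < g e (x(e := 1))" if "\<And>d. d \<in> S \<Longrightarrow> 0 < x d"
    using that by (intro triangular_pos[OF tri]) auto
  ultimately show "(\<And>d. d \<in> S \<Longrightarrow> 0 < x d) \<Longrightarrow> 0 < g e x"
    by simp
qed

lemma orthant_restrict: "x \<in> orthant (insert e S) \<Longrightarrow> restrict x S \<in> orthant S"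
  by auto

lemma fun_upd_restrict_orthant: "x \<in> orthant (insert e S) \<Longrightarrow> (restrict x S)(e := x e) = x"
  by (auto simp: fun_eq_iff PiE_def extensional_def)

text \<open>Indices are added in order of rank. The coordinates in \<open>S\<close> are recovered by
  the induction hypothesis; they determine the positive coefficient of the new coordinate, whose
  inversion can then be undone.\<close>

lemma bij_betw_recip_map:
  assumes "finite S" "triangular r g S"
  shows "bij_betw (recip_map g S) (orthant S) (orthant S)"
  using assms
proof (induction S rule: finite_ranking_induct[where f = r])
  case empty
  then show ?case by (simp add: recip_map_def bij_betw_def)
next
  case (insert e S)
  show ?case
  \<comment> \<open>The ranking induction does not exclude that the inserted index is already
    present.\<close>
  proof (cases "e \<in> S")
    case True
    with insert show ?thesis by (simp add: insert_absorb)
  next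
    case False
    let ?G = "recip_map g S" and ?G' = "recip_map g (insert e S)"
    have le: "\<forall>d\<in>S. r d \<le> r e"
      using insert.hyps(2) by simp
    note last = triangular_last[OF insert.prems False]
    note ins = recip_map_insert[OF insert.prems le False]
    have bij: "bij_betw ?G (orthant S) (orthant S)"
      by (rule insert.IH[OF triangular_subset[OF insert.prems le False]])
    have G': "?G' x = (?G (restrict x S))(e := g e (restrict x S) / x e)" if "x \<in> orthant (insert e S)" for x
      using ins[of "restrict x S" "x e"] by (simp only: fun_upd_restrict_orthant[OF that])
    have maps: "?G' x \<in> orthant (insert e S)" if "x \<in> orthant (insert e S)" for x
    proof -
      have "?G (restrict x S) \<in> orthant S"
        using bij_betwE[OF bij] orthant_restrict[OF that] by blast
      moreover have "0 < g e (restrict x S)"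
        using that by (intro last(2)) auto
      moreover have "0 < x e"
        using that by auto
      ultimately show ?thesis
        unfolding G'[OF that] by (intro PiE_fun_upd) auto
    qed
    show ?thesis
    proof (rule bij_betwI')
      fix x y assume xy: "x \<in> orthant (insert e S)" "y \<in> orthant (insert e S)"
      show "?G' x = ?G' y \<longleftrightarrow> x = y"
      proof
        assume eq: "?G' x = ?G' y"
        \<comment> \<open>Resetting the coordinate \<open>e\<close> to \<open>undefined\<close>, the
          value of restricted functions outside their domain, leaves the image under the smaller
          map.\<close>
        have upd: "(?G' z)(e := undefined) = ?G (restrict z S)" if "z \<in> orthant (insert e S)" for z
          unfolding G'[OF that] using False by (auto simp: recip_map_def fun_eq_iff)
        have "?G (restrict x S) = ?G (restrict y S)"
          unfolding upd[OF xy(1), symmetric] upd[OF xy(2), symmetric] eq ..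
        then have r: "restrict x S = restrict y S"
          by (rule inj_onD[OF bij_betw_imp_inj_on[OF bij]]) (rule orthant_restrict xy)+
        have "g e (restrict x S) / x e = g e (restrict x S) / y e"
          using fun_cong[OF eq, of e] unfolding G'[OF xy(1)] G'[OF xy(2)] r by simp
        moreover have "0 < g e (restrict x S)"
          using xy(1) by (intro last(2)) auto
        ultimately have "x e = y e"
          unfolding divide_cancel_left by simp
        have "x = (restrict x S)(e := x e)"
          by (rule fun_upd_restrict_orthant[OF xy(1), symmetric])
        also have "\<dots> = (restrict y S)(e := y e)"
          by (simp only: r \<open>x e = y e\<close>)
        also have "\<dots> = y"
          by (rule fun_upd_restrict_orthant[OF xy(2)])
        finally show "x = y" .
      qed simp
    next
      fix y assume y: "y \<in> orthant (insert e S)"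
      have "restrict y S \<in> ?G ` orthant S"
        unfolding bij_betw_imp_surj_on[OF bij] by (rule orthant_restrict[OF y])
      then obtain x where x: "x \<in> orthant S" "?G x = restrict y S"
        by (elim imageE) simp
      have g: "0 < g e x" using x by (intro last(2)) auto
      \<comment> \<open>The last coordinate solves \<open>g e x / v = y e\<close> for
        \<open>v\<close>.\<close>
      let ?x = "x(e := g e x / y e)"
      have "0 < y e" using y by auto
      have mem: "?x \<in> orthant (insert e S)"
        using g x(1) \<open>0 < y e\<close> by (intro PiE_fun_upd) simp_all
      have "?G' ?x = (restrict y S)(e := y e)"
        unfolding ins x(2) using g by simp
      also have "\<dots> = y"
        by (rule fun_upd_restrict_orthant[OF y])
      finally show "\<exists>x\<in>orthant (insert e S). y = ?G' x"
        using mem by (intro bexI[of _ ?x]) simp_all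
    qed (rule maps)
  qed
qed

lemma orthant_sets [measurable]: "finite S \<Longrightarrow> orthant S \<in> sets (\<Pi>\<^sub>M _\<in>S. haar)"
  by (intro sets_PiM_I_finite) auto

text \<open>By Fubini the coordinate of maximal rank is integrated first. With the others fixed its
  coefficient is a constant, so \<open>nn_integral_haar_inverse\<close> removes the inversion; the
  outer integral falls to the induction hypothesis, for which \<open>h\<close> must be
  arbitrary.\<close>

lemma nn_integral_recip_map:
  assumes "finite S" "triangular r g S" "h \<in> borel_measurable (\<Pi>\<^sub>M _\<in>S. haar)"
  shows "(\<integral>\<^sup>+x. indicator (orthant S) x * h (recip_map g S x) \<partial>(\<Pi>\<^sub>M _\<in>S. haar))
    = (\<integral>\<^sup>+x. indicator (orthant S) x * h x \<partial>(\<Pi>\<^sub>M _\<in>S. haar))"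
  using assms
proof (induction S arbitrary: h rule: finite_ranking_induct[where f = r])
  case empty
  have "recip_map g {} x = x" if "x \<in> orthant {}" for x
    using that by (auto simp: recip_map_def fun_eq_iff)
  then show ?case by (intro nn_integral_cong) (auto split: split_indicator)
next
  case (insert e S)
  show ?case
  proof (cases "e \<in> S")
    case True
    with insert show ?thesis by (simp add: insert_absorb)
  next
    case False
    let ?G = "recip_map g S" and ?G' = "recip_map g (insert e S)"
    let ?P = "\<Pi>\<^sub>M _\<in>S. haar"
    have le: "\<forall>d\<in>S. r d \<le> r e"
      using insert.hyps(2) by simp
    note last = triangular_last[OF insert.prems(1) False]
    note ins = recip_map_insert[OF insert.prems(1) le False]
    have triS: "triangular r g S"
      by (rule triangular_subset[OF insert.prems(1) le False])
    note [measurable] = insert.prems(2) recip_map_measurable[OF insert.prems(1)] recip_map_measurable[OF triS]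
    have fin: "finite S" "finite (insert e S)" using insert by auto
    note [measurable] = orthant_sets[OF fin(1)] orthant_sets[OF fin(2)]
    \<comment> \<open>The integrand for the induction hypothesis: \<open>h\<close> with the last
      coordinate integrated out over the positive half-line.\<close>
    define H where "H x = (\<integral>\<^sup>+y. indicator {0<..} y * h (x(e := y)) \<partial>haar)" for x
    interpret sf: sigma_finite_measure haar by (rule sigma_finite_haar)
    have [measurable]: "(\<lambda>(x, y). x(e := y)) \<in> ?P \<Otimes>\<^sub>M haar \<rightarrow>\<^sub>M (\<Pi>\<^sub>M _\<in>insert e S. haar)"
      by (rule measurable_add_dim)
    have H: "H \<in> borel_measurable ?P"
      unfolding H_def by measurable
    have ind: "indicator (orthant (insert e S)) (x(e := y)) = (indicator (orthant S) x * indicator {0<..} y :: ennreal)"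
      if "x \<in> space ?P" for x y
      using that False by (auto simp: space_PiM PiE_iff extensional_def split: split_indicator if_splits)
    have "(\<integral>\<^sup>+x. indicator (orthant (insert e S)) x * h (?G' x) \<partial>(\<Pi>\<^sub>M _\<in>insert e S. haar))
        = (\<integral>\<^sup>+x. (\<integral>\<^sup>+y. indicator (orthant (insert e S)) (x(e := y)) * h (?G' (x(e := y))) \<partial>haar) \<partial>?P)"
      using insert.hyps False by (intro haar.product_nn_integral_insert) measurable
    also have "\<dots> = (\<integral>\<^sup>+x. indicator (orthant S) x * H (?G x) \<partial>?P)"
    proof (rule nn_integral_cong)
      fix x assume x: "x \<in> space ?P"
      have "(\<integral>\<^sup>+y. indicator (orthant (insert e S)) (x(e := y)) * h (?G' (x(e := y))) \<partial>haar)
          = (\<integral>\<^sup>+y. indicator (orthant S) x * (indicator {0<..} y * h ((?G x)(e := g e x / y))) \<partial>haar)"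
        by (intro nn_integral_cong) (simp add: ind[OF x] ins mult.assoc)
      also have "\<dots> = indicator (orthant S) x * H (?G x)"
      proof (cases "x \<in> orthant S")
        case True
        \<comment> \<open>The coefficient is known to be positive only on the orthant; elsewhere
          both sides are 0.\<close>
        then have c: "0 < g e x" by (intro last(2)) auto
        have Gx: "?G x \<in> space ?P"
          using x recip_map_measurable[OF triS] by (rule measurable_space[rotated])
        have [measurable]: "(\<lambda>y. (?G x)(e := y)) \<in> haar \<rightarrow>\<^sub>M (\<Pi>\<^sub>M _\<in>insert e S. haar)"
          using Gx False by (rule measurable_component_update)
        have "(\<lambda>y. indicator {0<..} y * h ((?G x)(e := y))) \<in> borel_measurable haar"
          by measurable
        then have "(\<integral>\<^sup>+y. indicator {0<..} (g e x / y) * h ((?G x)(e := g e x / y)) \<partial>haar) = H (?G x)"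
          unfolding H_def using c by (intro nn_integral_haar_inverse) (auto cong: measurable_cong_sets)
        moreover have "indicator {0<..} (g e x / y) = (indicator {0<..} y :: ennreal)" for y
          using c by (auto simp: zero_less_divide_iff split: split_indicator)
        ultimately show ?thesis using True by simp
      qed simp
      finally show "(\<integral>\<^sup>+y. indicator (orthant (insert e S)) (x(e := y)) * h (?G' (x(e := y))) \<partial>haar)
          = indicator (orthant S) x * H (?G x)" .
    qed
    also have "\<dots> = (\<integral>\<^sup>+x. indicator (orthant S) x * H x \<partial>?P)"
      by (rule insert.IH[OF triS H])
    also have "\<dots> = (\<integral>\<^sup>+x. (\<integral>\<^sup>+y. indicator (orthant (insert e S)) (x(e := y)) * h (x(e := y)) \<partial>haar) \<partial>?P)"
    proof (rule nn_integral_cong)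
      fix x assume x: "x \<in> space ?P"
      have [measurable]: "(\<lambda>y. x(e := y)) \<in> haar \<rightarrow>\<^sub>M (\<Pi>\<^sub>M _\<in>insert e S. haar)"
        using x False by (rule measurable_component_update)
      show "indicator (orthant S) x * H x
          = (\<integral>\<^sup>+y. indicator (orthant (insert e S)) (x(e := y)) * h (x(e := y)) \<partial>haar)"
        unfolding H_def by (subst nn_integral_cmult[symmetric]) (auto simp: ind[OF x] mult.assoc)
    qed
    also have "\<dots> = (\<integral>\<^sup>+x. indicator (orthant (insert e S)) x * h x \<partial>(\<Pi>\<^sub>M _\<in>insert e S. haar))"
      using insert.hyps False by (intro haar.product_nn_integral_insert[symmetric]) measurable
    finally show ?thesis .
  qed
qed

text \<open>On boxes the reindexing merely permutes the sides, and all coordinates carry the same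
  measure.\<close>

lemma distr_reindex_involution:
  assumes fin: "finite I" and s: "\<And>e. e \<in> I \<Longrightarrow> s e \<in> I" "\<And>e. e \<in> I \<Longrightarrow> s (s e) = e"
  shows "distr (\<Pi>\<^sub>M _\<in>I. haar) (\<Pi>\<^sub>M _\<in>I. haar) (\<lambda>x. \<lambda>e\<in>I. x (s e)) = (\<Pi>\<^sub>M _\<in>I. haar)"
proof (rule haar.PiM_eqI[OF fin])
  have [measurable]: "(\<lambda>x. \<lambda>e\<in>I. x (s e)) \<in> (\<Pi>\<^sub>M _\<in>I. haar) \<rightarrow>\<^sub>M (\<Pi>\<^sub>M _\<in>I. haar)"
    using s by (intro measurable_restrict measurable_component_singleton)
  fix A :: "'a \<Rightarrow> real set" assume A: "\<And>i. i \<in> I \<Longrightarrow> A i \<in> sets haar"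
  have "emeasure (distr (\<Pi>\<^sub>M _\<in>I. haar) (\<Pi>\<^sub>M _\<in>I. haar) (\<lambda>x. \<lambda>e\<in>I. x (s e))) (Pi\<^sub>E I A)
      = emeasure (\<Pi>\<^sub>M _\<in>I. haar) ((\<lambda>x. \<lambda>e\<in>I. x (s e)) -` Pi\<^sub>E I A \<inter> space (\<Pi>\<^sub>M _\<in>I. haar))"
    using fin A by (intro emeasure_distr) (auto intro!: sets_PiM_I_finite)
  also have "(\<lambda>x. \<lambda>e\<in>I. x (s e)) -` Pi\<^sub>E I A \<inter> space (\<Pi>\<^sub>M _\<in>I. haar) = (\<Pi>\<^sub>E e\<in>I. A (s e))"
  proof -
    have "(\<forall>e\<in>I. x (s e) \<in> A e) \<longleftrightarrow> (\<forall>e\<in>I. x e \<in> A (s e))" for x :: "'a \<Rightarrow> real"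
    proof (intro iffI ballI)
      fix e assume "\<forall>e\<in>I. x (s e) \<in> A e" "e \<in> I"
      with s(1)[of e] s(2)[of e] show "x e \<in> A (s e)" by force
    next
      fix e assume "\<forall>e\<in>I. x e \<in> A (s e)" "e \<in> I"
      with s(1)[of e] s(2)[of e] show "x (s e) \<in> A e" by force
    qed
    then show ?thesis by (auto simp: space_PiM PiE_iff)
  qed
  also have "emeasure (\<Pi>\<^sub>M _\<in>I. haar) \<dots> = (\<Prod>e\<in>I. emeasure haar (A (s e)))"
    using fin A s by (intro haar.emeasure_PiM) auto
  also have "\<dots> = (\<Prod>e\<in>I. emeasure haar (A e))"
    using s by (intro prod.reindex_bij_witness[of _ s s]) auto
  finally show "emeasure (distr (\<Pi>\<^sub>M _\<in>I. haar) (\<Pi>\<^sub>M _\<in>I. haar) (\<lambda>x. \<lambda>e\<in>I. x (s e))) (Pi\<^sub>E I A)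
      = (\<Prod>e\<in>I. emeasure haar (A e))" .
qed simp

text \<open>Tested on boxes, where the integrand splits into functions of single
  coordinates.\<close>

lemma PiM_haar_density:
  assumes fin: "finite I"
  shows "(\<Pi>\<^sub>M _\<in>I. haar) = density (\<Pi>\<^sub>M _\<in>I. lborel) (\<lambda>x. \<Prod>e\<in>I. ennreal (indicator {0<..} (x e) / x e))"
proof (rule haar.PiM_eqI[OF fin, symmetric])
  interpret lb: product_sigma_finite "\<lambda>_::'a. lborel :: real measure"
    by (simp add: product_sigma_finite_def lborel.sigma_finite_measure_axioms)
  show "sets (density (\<Pi>\<^sub>M _\<in>I. lborel) (\<lambda>x. \<Prod>e\<in>I. ennreal (indicator {0<..} (x e) / x e)))
      = sets (\<Pi>\<^sub>M _\<in>I. haar)"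
    by (auto intro!: sets_PiM_cong)
  fix A :: "'a \<Rightarrow> real set" assume A: "\<And>i. i \<in> I \<Longrightarrow> A i \<in> sets haar"
  have "emeasure (density (\<Pi>\<^sub>M _\<in>I. lborel) (\<lambda>x. \<Prod>e\<in>I. ennreal (indicator {0<..} (x e) / x e))) (Pi\<^sub>E I A)
      = (\<integral>\<^sup>+x. (\<Prod>e\<in>I. ennreal (indicator {0<..} (x e) / x e)) * indicator (Pi\<^sub>E I A) x \<partial>(\<Pi>\<^sub>M _\<in>I. lborel))"
    using fin A by (intro emeasure_density) (auto intro!: sets_PiM_I_finite)
  also have "\<dots> = (\<integral>\<^sup>+x. (\<Prod>e\<in>I. ennreal (indicator {0<..} (x e) / x e) * indicator (A e) (x e)) \<partial>(\<Pi>\<^sub>M _\<in>I. lborel))"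
  proof (rule nn_integral_cong)
    fix x :: "'a \<Rightarrow> real" assume "x \<in> space (\<Pi>\<^sub>M _\<in>I. lborel)"
    then have "indicator (Pi\<^sub>E I A) x = (\<Prod>e\<in>I. indicator (A e) (x e) :: ennreal)"
      using fin by (auto simp: space_PiM PiE_iff indicator_def prod_zero_iff)
    then show "(\<Prod>e\<in>I. ennreal (indicator {0<..} (x e) / x e)) * indicator (Pi\<^sub>E I A) x
        = (\<Prod>e\<in>I. ennreal (indicator {0<..} (x e) / x e) * indicator (A e) (x e))"
      by (simp add: prod.distrib)
  qed
  also have "\<dots> = (\<Prod>e\<in>I. \<integral>\<^sup>+x. ennreal (indicator {0<..} x / x) * indicator (A e) x \<partial>lborel)"
    using A fin by (intro lb.product_nn_integral_prod) auto
  also have "\<dots> = (\<Prod>e\<in>I. emeasure haar (A e))"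
    using A unfolding haar_def by (intro prod.cong refl emeasure_density[symmetric]) auto
  finally show "emeasure (density (\<Pi>\<^sub>M _\<in>I. lborel) (\<lambda>x. \<Prod>e\<in>I. ennreal (indicator {0<..} (x e) / x e))) (Pi\<^sub>E I A)
      = (\<Prod>e\<in>I. emeasure haar (A e))" .
qed

section \<open>Comparison of the product of Haar measures with \<open>log_measure\<close>\<close>

lemma pos_orthant_eq: "pos_orthant n = orthant (idx n)"
  by (simp add: pos_orthant_def)

lemma finite_idx [simp]: "finite (idx n)"
  by (rule finite_subset[of _ "{..n} \<times> {..n}"]) (auto simp: idx_def)

lemma sets_PiM_haar: "sets (\<Pi>\<^sub>M _\<in>I. haar) = sets (\<Pi>\<^sub>M _\<in>I. lborel)"
  by (intro sets_PiM_cong) simp_all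

lemma pos_orthant_sets: "pos_orthant n \<in> sets (\<Pi>\<^sub>M _\<in>idx n. lborel)"
  using orthant_sets[of "idx n"] by (simp add: pos_orthant_eq sets_PiM_haar)

lemma sets_log_measure:
  "sets (log_measure n) = sets (restrict_space (\<Pi>\<^sub>M _\<in>idx n. haar) (pos_orthant n))"
  unfolding log_measure_def sets_density
  by (intro sets_restrict_space_cong) (simp add: sets_PiM_haar)

lemma space_log_measure: "space (log_measure n) = pos_orthant n"
  unfolding log_measure_def by (auto simp: space_restrict_space space_PiM pos_orthant_def)

text \<open>On the orthant the two densities coincide. The restricted space is traded for an
  indicator, so that the integral formulas on the full product space become applicable.\<close>

lemma emeasure_log_measure:
  assumes A: "A \<in> sets (log_measure n)"
  shows "emeasure (log_measure n) A
    = (\<integral>\<^sup>+x. indicator (pos_orthant n) x * indicator A x \<partial>(\<Pi>\<^sub>M _\<in>idx n. haar))"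
proof -
  let ?L = "\<Pi>\<^sub>M _\<in>idx n. lborel :: real measure"
  let ?O = "pos_orthant n"
  have O: "?O \<inter> space ?L \<in> sets ?L" "?O \<in> sets ?L"
    using pos_orthant_sets by auto
  have A': "A \<in> sets (restrict_space ?L ?O)"
    using A unfolding log_measure_def by simp
  then have AL: "A \<in> sets ?L"
    using O(1) by (simp add: sets_restrict_space_iff)
  have "(\<lambda>x. ennreal (\<Prod>ij\<in>idx n. 1 / x ij)) \<in> borel_measurable ?L"
    by measurable
  then have "(\<lambda>x. ennreal (\<Prod>ij\<in>idx n. 1 / x ij)) \<in> borel_measurable (restrict_space ?L ?O)"
    by (rule measurable_restrict_space1)
  then have "emeasure (log_measure n) A
      = (\<integral>\<^sup>+x. ennreal (\<Prod>ij\<in>idx n. 1 / x ij) * indicator A x \<partial>restrict_space ?L ?O)"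
    unfolding log_measure_def using A' by (rule emeasure_density)
  also have "\<dots> = (\<integral>\<^sup>+x. ennreal (\<Prod>ij\<in>idx n. 1 / x ij) * indicator A x * indicator ?O x \<partial>?L)"
    by (rule nn_integral_restrict_space[OF O(1)])
  also have "\<dots> = (\<integral>\<^sup>+x. (\<Prod>e\<in>idx n. ennreal (indicator {0<..} (x e) / x e)) * (indicator ?O x * indicator A x) \<partial>?L)"
  proof (rule nn_integral_cong)
    fix x
    show "ennreal (\<Prod>ij\<in>idx n. 1 / x ij) * indicator A x * indicator ?O x
        = (\<Prod>e\<in>idx n. ennreal (indicator {0<..} (x e) / x e)) * (indicator ?O x * indicator A x)"
    proof (cases "x \<in> ?O")
      case True
      then have pos: "0 < x e" if "e \<in> idx n" for e
        using that by (auto simp: pos_orthant_def)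
      have "ennreal (\<Prod>ij\<in>idx n. 1 / x ij) = (\<Prod>e\<in>idx n. ennreal (1 / x e))"
        using pos by (intro prod_ennreal[symmetric]) (simp add: less_imp_le)
      also have "\<dots> = (\<Prod>e\<in>idx n. ennreal (indicator {0<..} (x e) / x e))"
        using pos by (intro prod.cong) simp_all
      finally show ?thesis by (simp add: ac_simps)
    qed simp
  qed
  also have "\<dots> = (\<integral>\<^sup>+x. indicator ?O x * indicator A x
      \<partial>density ?L (\<lambda>x. \<Prod>e\<in>idx n. ennreal (indicator {0<..} (x e) / x e)))"
  proof (rule nn_integral_density[symmetric])
    show "(\<lambda>x. indicator ?O x * indicator A x :: ennreal) \<in> borel_measurable ?L"
      by (intro borel_measurable_times_ennreal borel_measurable_indicator O(2) AL)
  qed measurable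
  also have "\<dots> = (\<integral>\<^sup>+x. indicator ?O x * indicator A x \<partial>(\<Pi>\<^sub>M _\<in>idx n. haar))"
    by (simp add: PiM_haar_density)
  finally show ?thesis .
qed

text \<open>A reindexing by an involution follows the triangular map, since the parameters \<open>p\<close> are
  indexed in the reverse order within a row.\<close>

lemma preserves_log_measure_recip_map:
  assumes tri: "triangular r g (idx n)"
    and s: "\<And>e. e \<in> idx n \<Longrightarrow> s e \<in> idx n" "\<And>e. e \<in> idx n \<Longrightarrow> s (s e) = e"
    and F: "\<And>x. x \<in> pos_orthant n \<Longrightarrow> F x = (\<lambda>e\<in>idx n. recip_map g (idx n) x (s e))"
  shows "bij_betw F (pos_orthant n) (pos_orthant n)"
    and "F \<in> log_measure n \<rightarrow>\<^sub>M log_measure n"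
    and "distr (log_measure n) (log_measure n) F = log_measure n"
proof -
  let ?P = "\<Pi>\<^sub>M _\<in>idx n. haar"
  let ?O = "pos_orthant n"
  let ?G = "recip_map g (idx n)"
  define R where "R x = (\<lambda>e\<in>idx n. x (s e))" for x :: "nat \<times> nat \<Rightarrow> real"
  have FR: "F x = R (?G x)" if "x \<in> ?O" for x
    using F[OF that] by (simp add: R_def)
  have R_orthant: "R x \<in> ?O" if "x \<in> ?O" for x
    using that s(1) unfolding pos_orthant_def R_def by auto
  have RR: "R (R x) = x" if "x \<in> ?O" for x
  proof (rule ext)
    fix e
    show "R (R x) e = x e"
    proof (cases "e \<in> idx n")
      case True
      then show ?thesis using s by (simp add: R_def)
    next
      case False
      then show ?thesis using that PiE_arb[of x "idx n" "\<lambda>_. {0<..}" e] by (simp add: R_def pos_orthant_def)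
    qed
  qed
  have bijR: "bij_betw R ?O ?O"
    by (rule bij_betw_byWitness[of _ R]) (auto simp: RR R_orthant)
  have bijG: "bij_betw ?G ?O ?O"
    unfolding pos_orthant_eq by (rule bij_betw_recip_map[OF finite_idx tri])
  have "bij_betw (R \<circ> ?G) ?O ?O"
    by (rule bij_betw_trans[OF bijG bijR])
  then show bijF: "bij_betw F ?O ?O"
    by (rule bij_betw_cong[THEN iffD1, rotated]) (simp add: FR)
  have F_orthant: "F x \<in> ?O" if "x \<in> ?O" for x
    using bij_betwE[OF bijF] that by blast
  have O: "?O \<in> sets ?P"
    using orthant_sets[OF finite_idx] by (simp add: pos_orthant_eq)
  have R_meas: "R \<in> ?P \<rightarrow>\<^sub>M ?P"
    unfolding R_def[abs_def] by (intro measurable_restrict measurable_component_singleton s(1))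
  note G_meas = recip_map_measurable[OF tri]
  have "(\<lambda>x. R (?G x)) \<in> restrict_space ?P ?O \<rightarrow>\<^sub>M ?P"
    by (rule measurable_restrict_space1[OF measurable_compose[OF G_meas R_meas]])
  then have "F \<in> restrict_space ?P ?O \<rightarrow>\<^sub>M ?P"
    by (rule measurable_cong[THEN iffD1, rotated]) (simp add: FR space_restrict_space)
  then have "F \<in> restrict_space ?P ?O \<rightarrow>\<^sub>M restrict_space ?P ?O"
    by (intro measurable_restrict_space2) (auto simp: space_restrict_space F_orthant)
  then show F_meas: "F \<in> log_measure n \<rightarrow>\<^sub>M log_measure n"
    by (simp only: measurable_cong_sets[OF sets_log_measure sets_log_measure])
  show "distr (log_measure n) (log_measure n) F = log_measure n"
  proof (rule measure_eqI)
    fix A assume "A \<in> sets (distr (log_measure n) (log_measure n) F)"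
    then have A: "A \<in> sets (log_measure n)" by simp
    have AP: "A \<in> sets ?P"
      using A O unfolding sets_log_measure by (subst (asm) sets_restrict_space_iff) auto
    have h_meas: "(\<lambda>x. indicator A (R x) :: ennreal) \<in> borel_measurable ?P"
      using R_meas by (rule measurable_compose) (use AP in simp)
    have "emeasure (distr (log_measure n) (log_measure n) F) A
        = emeasure (log_measure n) (F -` A \<inter> ?O)"
      using emeasure_distr[OF F_meas A] by (simp add: space_log_measure)
    also have "\<dots> = (\<integral>\<^sup>+x. indicator ?O x * indicator (F -` A \<inter> ?O) x \<partial>?P)"
      using measurable_sets[OF F_meas A] by (intro emeasure_log_measure) (simp add: space_log_measure)
    also have "\<dots> = (\<integral>\<^sup>+x. indicator (orthant (idx n)) x * indicator A (R (?G x)) \<partial>?P)"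
      by (intro nn_integral_cong) (auto simp: FR simp flip: pos_orthant_eq split: split_indicator)
    also have "\<dots> = (\<integral>\<^sup>+x. indicator (orthant (idx n)) x * indicator A (R x) \<partial>?P)"
      by (rule nn_integral_recip_map[OF finite_idx tri h_meas])
    \<comment> \<open>The triangular map is gone; what remains is the reindexing, under which the
      orthant and the product measure are invariant.\<close>
    also have "\<dots> = (\<integral>\<^sup>+x. indicator ?O (R x) * indicator A (R x) \<partial>?P)"
    proof (rule nn_integral_cong)
      fix x assume x: "x \<in> space ?P"
      \<comment> \<open>Positivity of \<open>x e\<close> is that of \<open>R x\<close> at
        \<open>s e\<close>; that \<open>x\<close> is undefined outside \<open>idx n\<close> comes
        from its membership in the product space.\<close>
      have "x \<in> ?O" if "R x \<in> ?O"
      proof -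
        have "0 < x e" if "e \<in> idx n" for e
          using PiE_mem[OF \<open>R x \<in> ?O\<close>[unfolded pos_orthant_def] s(1)[OF that]] s that
          by (simp add: R_def)
        then show ?thesis
          using x by (auto simp: pos_orthant_def space_PiM PiE_iff)
      qed
      then have "R x \<in> ?O \<longleftrightarrow> x \<in> ?O"
        using R_orthant by blast
      then show "indicator (orthant (idx n)) x * indicator A (R x) = (indicator ?O (R x) * indicator A (R x) :: ennreal)"
        by (simp add: indicator_def pos_orthant_eq)
    qed
    also have "\<dots> = (\<integral>\<^sup>+x. indicator ?O x * indicator A x \<partial>distr ?P ?P R)"
      using R_meas O AP by (intro nn_integral_distr[symmetric]) simp_all
    also have "distr ?P ?P R = ?P"
      unfolding R_def[abs_def] by (rule distr_reindex_involution[OF finite_idx s])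
    also have "(\<integral>\<^sup>+x. indicator ?O x * indicator A x \<partial>?P) = emeasure (log_measure n) A"
      by (rule emeasure_log_measure[OF A, symmetric])
    finally show "emeasure (distr (log_measure n) (log_measure n) F) A = emeasure (log_measure n) A" .
  qed simp
qed

subsection \<open>Values of rational functions\<close>

definition monom_eval :: "(nat \<times> nat \<Rightarrow> real) \<Rightarrow> (nat \<Rightarrow>\<^sub>0 nat) \<Rightarrow> real" where
  "monom_eval x m = (\<Prod>k\<in>Poly_Mapping.keys m. x (prod_decode k) ^ Poly_Mapping.lookup m k)"

lemma monom_eval_superset:
  assumes "finite K" "Poly_Mapping.keys m \<subseteq> K"
  shows "monom_eval x m = (\<Prod>k\<in>K. x (prod_decode k) ^ Poly_Mapping.lookup m k)"
  unfolding monom_eval_def using assms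
  by (intro prod.mono_neutral_left) (auto simp: in_keys_iff)

lemma monom_eval_add: "monom_eval x (m + m') = monom_eval x m * monom_eval x m'"
proof -
  let ?K = "Poly_Mapping.keys m \<union> Poly_Mapping.keys m'"
  have "monom_eval x (m + m') = (\<Prod>k\<in>?K. x (prod_decode k) ^ Poly_Mapping.lookup (m + m') k)"
    using keys_add[of m m'] by (intro monom_eval_superset) auto
  also have "\<dots> = (\<Prod>k\<in>?K. x (prod_decode k) ^ Poly_Mapping.lookup m k)
      * (\<Prod>k\<in>?K. x (prod_decode k) ^ Poly_Mapping.lookup m' k)"
    by (simp add: lookup_add power_add prod.distrib)
  also have "\<dots> = monom_eval x m * monom_eval x m'"
    by (simp add: monom_eval_superset[of ?K m] monom_eval_superset[of ?K m'])
  finally show ?thesis .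
qed

lemma mpol_eval_eq: "mpol_eval x q = (\<Sum>m\<in>Poly_Mapping.keys q. Poly_Mapping.lookup q m * monom_eval x m)"
  by (simp add: mpol_eval_def monom_eval_def)

lemma mpol_eval_add: "mpol_eval x (p + q) = mpol_eval x p + mpol_eval x q"
  unfolding mpol_eval_eq
  by (rule setsum_keys_plus_distrib) (simp_all add: distrib_right)

lemma mpol_eval_zero [simp]: "mpol_eval x 0 = 0"
  by (simp add: mpol_eval_def)

lemma mpol_eval_single: "mpol_eval x (Poly_Mapping.single m c) = c * monom_eval x m"
  by (simp add: mpol_eval_eq)

lemma mpol_induct [case_names zero add]:
  fixes q :: mpol
  assumes "P 0" "\<And>m c q. P q \<Longrightarrow> P (Poly_Mapping.single m c + q)"
  shows "P q"
proof (induction q rule: update_induct)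
  case const
  show ?case by (rule assms(1))
next
  case (update f a b)
  have "Poly_Mapping.update a b f = Poly_Mapping.single a b + f"
    using update(1) by (intro poly_mapping_eqI)
      (auto simp: lookup_update lookup_add lookup_single in_keys_iff when_def)
  then show ?case using assms(2)[OF update(3)] by simp
qed

text \<open>Both sides are additive in either factor, which reduces the claim to two
  monomials.\<close>

lemma mpol_eval_mult: "mpol_eval x (p * q) = mpol_eval x p * mpol_eval x q"
proof (induction p rule: mpol_induct)
  case (add m c p)
  have "mpol_eval x (Poly_Mapping.single m c * q) = c * monom_eval x m * mpol_eval x q"
  proof (induction q rule: mpol_induct)
    case (add m' c' q)
    then show ?case
      by (simp add: distrib_left mpol_eval_add mult_single mpol_eval_single monom_eval_add)
  qed simp
  with add show ?case
    by (simp add: distrib_right mpol_eval_add mpol_eval_single)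
qed simp

lemma mpol_eval_one [simp]: "mpol_eval x 1 = 1"
  unfolding single_one[symmetric] mpol_eval_single by (simp add: monom_eval_def)

text \<open>Two representations satisfy a cross-multiplied polynomial identity, which survives
  evaluation at \<open>x\<close>. This makes the description in \<open>ratfun_eval\<close>
  meaningful.\<close>

lemma ratfun_value_unique:
  assumes "ratfun_value x f v" "ratfun_value x f w"
  shows "v = w"
proof -
  obtain a b where ab: "f = Fract a b" "mpol_eval x b \<noteq> 0" "v = mpol_eval x a / mpol_eval x b"
    using assms(1) unfolding ratfun_value_def by blast
  obtain c d where cd: "f = Fract c d" "mpol_eval x d \<noteq> 0" "w = mpol_eval x c / mpol_eval x d"
    using assms(2) unfolding ratfun_value_def by blast
  have "b \<noteq> 0" "d \<noteq> 0" using ab(2) cd(2) by auto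
  then have "a * d = c * b" using ab(1) cd(1) by (simp add: eq_fract)
  then have "mpol_eval x a * mpol_eval x d = mpol_eval x c * mpol_eval x b"
    by (metis mpol_eval_mult)
  then show ?thesis using ab cd by (simp add: frac_eq_eq)
qed

lemma ratfun_eval_eq: "ratfun_value x f v \<Longrightarrow> ratfun_eval x f = v"
  unfolding ratfun_eval_def by (rule the_equality) (auto dest: ratfun_value_unique)

lemma ratfun_value_one: "ratfun_value x 1 1"
  unfolding ratfun_value_def by (intro exI[of _ 1]) (simp add: One_fract_def)

lemma ratfun_value_mult:
  assumes "ratfun_value x f v" "ratfun_value x g w"
  shows "ratfun_value x (f * g) (v * w)"
proof -
  obtain a b c d where
    "f = Fract a b" "mpol_eval x b \<noteq> 0" "v = mpol_eval x a / mpol_eval x b"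
    "g = Fract c d" "mpol_eval x d \<noteq> 0" "w = mpol_eval x c / mpol_eval x d"
    using assms unfolding ratfun_value_def by auto
  then show ?thesis
    unfolding ratfun_value_def by (intro exI[of _ "a * c"] exI[of _ "b * d"]) (simp add: mpol_eval_mult)
qed

lemma ratfun_value_inverse:
  assumes "ratfun_value x f v" "v \<noteq> 0"
  shows "ratfun_value x (inverse f) (inverse v)"
proof -
  obtain a b where "f = Fract a b" "mpol_eval x b \<noteq> 0" "v = mpol_eval x a / mpol_eval x b"
    using assms unfolding ratfun_value_def by auto
  with assms(2) show ?thesis
    unfolding ratfun_value_def by (intro exI[of _ b] exI[of _ a]) simp
qed

lemma ratfun_value_divide:
  "ratfun_value x f v \<Longrightarrow> ratfun_value x g w \<Longrightarrow> w \<noteq> 0 \<Longrightarrow> ratfun_value x (f / g) (v / w)"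
  unfolding divide_inverse by (intro ratfun_value_mult ratfun_value_inverse)

lemma ratfun_value_prod:
  "(\<And>k. k \<in> K \<Longrightarrow> ratfun_value x (f k) (v k)) \<Longrightarrow> ratfun_value x (\<Prod>k\<in>K. f k) (\<Prod>k\<in>K. v k)"
proof (induction K rule: infinite_finite_induct)
  case (insert k K)
  then show ?case by (simp add: ratfun_value_mult)
qed (simp_all add: ratfun_value_one)

lemma ratfun_value_tvar: "ratfun_value x (tvar i j) (x (i, j))"
  unfolding ratfun_value_def tvar_def
  by (intro exI[of _ "Poly_Mapping.single (Poly_Mapping.single (prod_encode (i, j)) 1) 1"] exI[of _ 1])
    (simp add: mpol_eval_single monom_eval_def)

text \<open>At the point with all coordinates 1 a variable has the value 1, the zero function the
  value 0.\<close>

lemma tvar_nonzero: "tvar i j \<noteq> 0"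
proof
  assume "tvar i j = 0"
  then have "ratfun_value (\<lambda>_. 1) (tvar i j) 0"
    unfolding ratfun_value_def by (intro exI[of _ 0] exI[of _ 1]) (simp add: Zero_fract_def)
  with ratfun_value_tvar[of "\<lambda>_. 1" i j] show False
    using ratfun_value_unique by fastforce
qed

subsection \<open>The transform\<close>

text \<open>The index (i, k) is that of the variable \<open>t i k\<close> being inverted, not that
  of the parameter \<open>p\<close>. Only rows above row \<open>i\<close> enter, so the row number
  serves as rank.\<close>

definition bz_coeff :: "nat \<times> nat \<Rightarrow> (nat \<times> nat \<Rightarrow> real) \<Rightarrow> real" where
  "bz_coeff = (\<lambda>(i, k) x. \<Prod>l=1..<i. x (l, k - 1) / x (l, k))"

lemma triangular_bz_coeff: "triangular fst bz_coeff (idx n)"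
  unfolding triangular_def
proof (intro conjI ballI allI impI)
  fix e assume e: "e \<in> idx n"
  obtain i k where ik: "e = (i, k)" by (cases e)
  have idx: "(l, k - 1) \<in> idx n" "(l, k) \<in> idx n" if "l \<in> {1..<i}" for l
    using e that by (auto simp: idx_def ik)
  show "bz_coeff e x = bz_coeff e y" if "\<forall>d\<in>idx n. fst d < fst e \<longrightarrow> x d = y d" for x y
    unfolding bz_coeff_def ik prod.case using that idx by (intro prod.cong) (simp_all add: ik)
  show "0 < bz_coeff e x" if "\<forall>d\<in>idx n. 0 < x d" for x
    unfolding bz_coeff_def ik prod.case using that idx by (intro prod_pos) simp
  have "(\<lambda>x. x d) \<in> borel_measurable (\<Pi>\<^sub>M _\<in>idx n. haar)" if "d \<in> idx n" for d
    using measurable_component_singleton[OF that, of "\<lambda>_. haar"]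
    by (simp add: measurable_cong_sets[OF refl sets_haar])
  then have "(\<lambda>x. \<Prod>l=1..<i. x (l, k - 1) / x (l, k)) \<in> borel_measurable (\<Pi>\<^sub>M _\<in>idx n. haar)"
    using idx by (intro borel_measurable_prod borel_measurable_divide) simp_all
  then show "bz_coeff e \<in> borel_measurable (\<Pi>\<^sub>M _\<in>idx n. haar)"
    by (simp add: bz_coeff_def ik)
qed

text \<open>Takes the index of a parameter \<open>p i j\<close> to that of the variable it inverts.
  Within row \<open>i\<close> it reverses the columns from \<open>i + 1\<close> to \<open>n\<close>,
  hence is an involution of \<open>idx n\<close>.\<close>

definition row_reversal :: "nat \<Rightarrow> nat \<times> nat \<Rightarrow> nat \<times> nat" where
  "row_reversal n = (\<lambda>(i, j). (i, i + (n + 1 - j)))"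

text \<open>All denominators are variables, which do not vanish on the orthant, so the formula may
  be evaluated termwise.\<close>

lemma ratfun_value_bz:
  assumes x: "x \<in> pos_orthant n" and e: "(i, j) \<in> idx n"
  shows "ratfun_value x (bz n tvar i j) (recip_map bz_coeff (idx n) x (row_reversal n (i, j)))"
proof -
  define k where "k = i + (n + 1 - j)"
  have idx: "(i, k) \<in> idx n" "\<And>l. l \<in> {1..<i} \<Longrightarrow> (l, k) \<in> idx n"
    using e by (auto simp: idx_def k_def)
  have nz: "x d \<noteq> 0" if "d \<in> idx n" for d
    using PiE_mem[OF x[unfolded pos_orthant_def] that] by simp
  have "ratfun_value x (1 / tvar i k * (\<Prod>l=1..<i. tvar l (k - 1) / tvar l k))
      (1 / x (i, k) * (\<Prod>l=1..<i. x (l, k - 1) / x (l, k)))"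
    by (intro ratfun_value_mult ratfun_value_divide ratfun_value_prod ratfun_value_one ratfun_value_tvar nz idx)
  moreover have "row_reversal n (i, j) = (i, k)"
    by (simp add: row_reversal_def k_def)
  then have "recip_map bz_coeff (idx n) x (row_reversal n (i, j))
      = 1 / x (i, k) * (\<Prod>l=1..<i. x (l, k - 1) / x (l, k))"
    using idx(1) by (simp add: recip_map_def bz_coeff_def)
  ultimately show ?thesis
    by (simp add: bz_def Let_def k_def)
qed

text \<open>On the orthant the real map is the triangular inversion with coefficients
  \<open>bz_coeff\<close>, followed by the row reversal. Agreement of \<open>p\<close> with
  \<open>bz\<close> on \<open>idx n\<close> suffices, since \<open>real_map\<close> reads no other
  values.\<close>

lemma preserves_log_measure_bz:
  assumes p: "\<And>i j. 1 \<le> i \<Longrightarrow> i < j \<Longrightarrow> j \<le> n \<Longrightarrow> p i j = bz n tvar i j"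
  shows "preserves_log_measure n p"
proof -
  have val: "ratfun_value x (p i j) (recip_map bz_coeff (idx n) x (row_reversal n (i, j)))"
    if "x \<in> pos_orthant n" "(i, j) \<in> idx n" for x i j
    using ratfun_value_bz[OF that] p[of i j] that(2) by (simp add: idx_def)
  have F: "real_map n p x = (\<lambda>e\<in>idx n. recip_map bz_coeff (idx n) x (row_reversal n e))"
    if "x \<in> pos_orthant n" for x
    unfolding real_map_def
    by (rule restrict_ext) (auto simp: ratfun_eval_eq[OF val[OF that]])
  have s: "row_reversal n e \<in> idx n" "row_reversal n (row_reversal n e) = e" if "e \<in> idx n" for e
    using that by (auto simp: idx_def row_reversal_def)
  note * = preserves_log_measure_recip_map[OF triangular_bz_coeff s F]
  show ?thesis
    unfolding preserves_log_measure_def ratfun_regular_def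
    using val * by blast
qed

text \<open>Existence is a separate conjunct because the remaining claims are made for every
  factorization and would otherwise be compatible with there being none.\<close>

theorem theorem3p1:
  fixes n :: nat
  assumes "n \<ge> 2"
  shows "(\<exists>Y T p. BZ_factorization n tvar Y T p) \<and>
    (\<forall>Y T p. BZ_factorization n tvar Y T p \<longrightarrow>
      (\<forall>i j. 1 \<le> i \<and> i < j \<and> j \<le> n \<longrightarrow>
        (let j' = n + 1 - j in
          p i j = 1 / tvar i (i + j') *
            (\<Prod>k=1..<i. tvar k (i + j' - 1) / tvar k (i + j')))) \<and>
      T = mat_sum n
        (\<lambda>i. ((\<Prod>j=i+1..n. tvar i j) / (\<Prod>k=1..<i. tvar k i)) \<cdot>\<^sub>m munit n i i) {1..n} \<and>
      preserves_log_measure n p)"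
proof (intro conjI allI impI)
  have nz: "tvar i j \<noteq> 0" if "1 \<le> i" "i < j" "j \<le> n" for i j
    by (rule tvar_nonzero)
  have "\<exists>Y. BZ_factorization n tvar Y (twist n tvar) (bz n tvar)"
    by (rule BZ_factorization_bz) (rule nz)
  then show "\<exists>Y T p. BZ_factorization n tvar Y T p"
    by blast
  fix Y T p assume fact: "BZ_factorization n tvar Y T p"
  have p: "p i j = bz n tvar i j" if "1 \<le> i" "i < j" "j \<le> n" for i j
    by (rule BZ_factorization_unique(2)[OF _ fact that]) (rule tvar_nonzero)
  show "let j' = n + 1 - j in p i j = 1 / tvar i (i + j') *
      (\<Prod>k=1..<i. tvar k (i + j' - 1) / tvar k (i + j'))" if "1 \<le> i \<and> i < j \<and> j \<le> n" for i j
    using p[of i j] that by (simp add: bz_def Let_def)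
  have "T = twist n tvar"
    by (rule BZ_factorization_unique(1)[OF _ fact]) (rule tvar_nonzero)
  then show "T = mat_sum n
      (\<lambda>i. ((\<Prod>j=i+1..n. tvar i j) / (\<Prod>k=1..<i. tvar k i)) \<cdot>\<^sub>m munit n i i) {1..n}"
    by (simp only: twist_def)
  show "preserves_log_measure n p"
    by (rule preserves_log_measure_bz) (rule p)
qed

end
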